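(* Let $f\colon S^1\to S^2$ be a normal immersion and $w(f)$ the corresponding reduced word. Then two different groupings define two different equivalence classes of extensions of $f$: if $\mathcal{G}_1$ and $\mathcal{G}_2$ are groupings of $f$ that are not equivalent (i.e. not isomorphic as weighted trees), and $F_1,F_2\colon\overline D\to S^2$ are the immersions extending $f$ that are induced by $\mathcal{G}_1$ and $\mathcal{G}_2$ respectively, then $F_1$ and $F_2$ are not equivalent extensions.
   Context: Immersions are smooth. $\overline D$ is the closed unit disc. A normal immersion $f\colon S^1\to S^2$ is an immersion all of whose self-intersections are transversal double points. An extension of $f$ is an immersion $F\colon\overline D\to S^2$ with $F|_{S^1}=f$. The sphere is oriented, and the surface lies to the left of the curve. Two extensions $F_1,F_2$ of $f$ are equivalent if there is an orientation preserving diffeomorphism $\phi\colon\overline D\to\overline D$ with $F_1=F_2\circ\phi$ and $\phi|_{S^1}=\mathrm{id}_{S^1}$. Words. Let $X_1,\dots,X_k$ be the components of $S^2\setminus f(S^1)$. A numbering is a function $\psi\colon\{X_1,\dots,X_k\}\to\mathbb{Z}$ with $\psi(X_j)=\psi(X_i)+1$ whenever $X_i,X_j$ share a boundary segment of $f(S^1)$ and $X_j$ lies to the left of it; it exists and is unique up to an additive constant. The base component is a component on which $\psi$ is minimal; fix a base point $x_0$ in it. In every other component $X_i$ pick a point $p_i$ and join $p_i$ to $x_0$ by a ray (a simple arc) $\hat c_i$, transverse to $f$ and avoiding double points, such that $\hat c_i\cap\hat c_l=\{x_0\}$ for $i\ne l$ and each $\hat c_i$ has a minimal number of intersection points with $f(S^1)$.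 Orient $\hat c_i$ from $p_i$ to $x_0$. Label an intersection point of $\hat c_i$ with $f(S^1)$ by $a_i$ if $\hat c_i$ crosses $f(S^1)$ from its left to its right, and by $a_i^{-1}$ if it crosses from right to left. The word $w(f)$ is the sequence of these labels in the order in which they appear when walking along $f(S^1)$ from an initial point $s$; it is determined up to cyclic permutation by the rays. A subword is a subsequence of consecutive letters. The word is reduced if it contains no subword $a_ia_i^{-1}$ or $a_i^{-1}a_i$ and is not of the form $a_i\cdots a_i^{-1}$ or $a_i^{-1}\cdots a_i$. Points and rays are chosen so that $w(f)$ is reduced, and they (and the first letter) are fixed. Groupings. A positive word is a word $a_ia_j\cdots a_k$ in letters with exponent $+1$ whose consecutive letters are different; the empty word is positive. A pairing is a subword $a_i^{\pm1}\,p\,a_i^{\mp1}$ with $p$ a positive word. A negative group is a subword $a_j^{-1}a_i^{-1}$ with $i\ne j$. Cancelling a pairing or negative group $\omega$ in a word $x_1\omega x_2$ means replacing the word by $x_1x_2$. The reduced word $w(f)$ is groupable if some successive cancellation of pairings and negative groups leads to a positive word. Each such cancellation induces a weighted tree, called a grouping of $f$: number the letters of $w(f)$ and mark their preimages on $S^1$; for each cancelled pairing or negative group join the preimages of its first and last letters by an arc (interval) in $\overline D$ transverse to $S^1$, all intervals being disjoint; the intervals cut $\overline D$ into smaller discs; take a vertex for each small disc and an edge for each interval (joining the two adjacent discs), labelled by $ij$ when the interval joins the letters numbered $i$ and $j$. Two groupings are equivalent if they are isomorphic as weighted (edge-labelled) trees. Extension induced by a grouping. An extension $F$ of $f$ is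 induced by the grouping $\mathcal{G}$ if there is a system of pairwise disjoint intervals in $\overline D$, transverse to $S^1$, one for each pairing or negative group cancelled in a cancellation inducing $\mathcal{G}$ and joining the preimages on $S^1$ of its first and last letters, whose associated weighted tree (a vertex for each small disc cut out by the intervals, an edge for each interval, labelled by the numbers of the two letters the interval joins) is $\mathcal{G}$, such that $F$ maps the interval of each pairing $a_i^{\pm1}\cdots a_i^{\mp1}$ diffeomorphically onto the part of $\hat c_i$ between the two corresponding intersection points, maps the interval of each negative group $a_j^{-1}a_i^{-1}$ diffeomorphically onto the path running along $\hat c_j$ from the corresponding intersection point to $x_0$ and then along $\hat c_i$ from $x_0$ to the other intersection point, and $F$ restricts to an embedding on each of the small closed discs into which the intervals cut $\overline D$. The equivalence class of such an $F$ is the equivalence class of extensions defined by $\mathcal{G}$. *)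

theory Defs
  imports "HOL-Analysis.Analysis"
begin

text \<open>
  The circle and the closed disc live in \<^typ>\<open>complex\<close>; the sphere is the unit sphere of
  \<^typ>\<open>real^3\<close>, oriented by its outward normal, so that at a point \<open>p\<close> the direction to the left
  of a tangent vector \<open>v\<close> is \<open>cross3 p v\<close>.
\<close>

abbreviation S1 :: "complex set" where "S1 \<equiv> sphere 0 1"
abbreviation D2 :: "complex set" where "D2 \<equiv> cball 0 1"
abbreviation S2 :: "(real^3) set" where "S2 \<equiv> sphere 0 1"


section \<open>Smooth maps\<close>

text \<open>Continuous differentiability of order \<open>k\<close>; meant for open \<open>U\<close>.\<close>

primrec Ck_on :: "nat \<Rightarrow> ('a::euclidean_space \<Rightarrow> 'b::euclidean_space) \<Rightarrow> 'a set \<Rightarrow> bool" where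
  "Ck_on 0 g U \<longleftrightarrow> continuous_on U g"
| "Ck_on (Suc k) g U \<longleftrightarrow>
     (\<exists>g'. (\<forall>x\<in>U. (g has_derivative g' x) (at x)) \<and> (\<forall>v. Ck_on k (\<lambda>x. g' x v) U))"

text \<open>Smoothness on an arbitrary subset: local existence of smooth extensions to open sets.\<close>

definition smooth_on :: "'a set \<Rightarrow> ('a::euclidean_space \<Rightarrow> 'b::euclidean_space) \<Rightarrow> bool" where
  "smooth_on S g \<longleftrightarrow>
     (\<forall>x\<in>S. \<exists>U h. open U \<and> x \<in> U \<and> (\<forall>k. Ck_on k h U) \<and> (\<forall>y\<in>S \<inter> U. h y = g y))"

definition diffeomorphism ::
  "'a set \<Rightarrow> 'b set \<Rightarrow> ('a::euclidean_space \<Rightarrow> 'b::euclidean_space) \<Rightarrow> bool" where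
  "diffeomorphism S T g \<longleftrightarrow> (\<exists>h. homeomorphism S T g h \<and> smooth_on S g \<and> smooth_on T h)"

definition regular_on :: "real set \<Rightarrow> (real \<Rightarrow> 'a::euclidean_space) \<Rightarrow> bool" where
  "regular_on J c \<longleftrightarrow> smooth_on J c \<and> (\<forall>t\<in>J. vector_derivative c (at t within J) \<noteq> 0)"


section \<open>Normal immersions and their extensions\<close>

text \<open>Derivative along the counterclockwise unit speed parametrization of the circle.\<close>

definition velocity :: "(complex \<Rightarrow> real^3) \<Rightarrow> complex \<Rightarrow> real^3" where
  "velocity f z = vector_derivative (\<lambda>t. f (z * cis t)) (at 0)"

definition immersed_circle :: "(complex \<Rightarrow> real^3) \<Rightarrow> bool" where
  "immersed_circle f \<longleftrightarrow> smooth_on S1 f \<and> f ` S1 \<subseteq> S2 \<and> (\<forall>z\<in>S1. velocity f z \<noteq> 0)"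

text \<open>Two vectors of \<^typ>\<open>real^3\<close> are linearly independent iff their cross product is nonzero.\<close>

definition normal_immersion :: "(complex \<Rightarrow> real^3) \<Rightarrow> bool" where
  "normal_immersion f \<longleftrightarrow>
     immersed_circle f \<and>
     (\<forall>p. finite {z\<in>S1. f z = p} \<and> card {z\<in>S1. f z = p} \<le> 2) \<and>
     (\<forall>z\<in>S1. \<forall>w\<in>S1. z \<noteq> w \<and> f z = f w \<longrightarrow> cross3 (velocity f z) (velocity f w) \<noteq> 0)"

definition double_point :: "(complex \<Rightarrow> real^3) \<Rightarrow> real^3 \<Rightarrow> bool" where
  "double_point f p \<longleftrightarrow> (\<exists>z\<in>S1. \<exists>w\<in>S1. z \<noteq> w \<and> f z = p \<and> f w = p)"

definition immersed_disc :: "(complex \<Rightarrow> real^3) \<Rightarrow> bool" where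
  "immersed_disc F \<longleftrightarrow>
     smooth_on D2 F \<and> F ` D2 \<subseteq> S2 \<and>
     (\<forall>z\<in>D2. \<exists>F'. (F has_derivative F') (at z within D2) \<and> inj F')"

text \<open>The last condition says that the surface lies to the left of the curve: \<open>F'\<close> maps the inward
  normal \<open>- z\<close> of the disc to the left side of the curve.\<close>

definition extension :: "(complex \<Rightarrow> real^3) \<Rightarrow> (complex \<Rightarrow> real^3) \<Rightarrow> bool" where
  "extension f F \<longleftrightarrow>
     immersed_disc F \<and>
     (\<forall>z\<in>S1. F z = f z) \<and>
     (\<forall>z\<in>S1. \<exists>F'. (F has_derivative F') (at z within D2) \<and>
                  0 < F' (- z) \<bullet> cross3 (f z) (velocity f z))"

text \<open>The real Jacobian determinant of a real linear map \<open>L\<close> of the plane is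
  \<open>Im (cnj (L 1) * L \<i>)\<close>.\<close>

definition orientation_preserving_disc :: "(complex \<Rightarrow> complex) \<Rightarrow> bool" where
  "orientation_preserving_disc \<phi> \<longleftrightarrow>
     (\<forall>z\<in>D2. \<exists>L. (\<phi> has_derivative L) (at z within D2) \<and> 0 < Im (cnj (L 1) * L \<i>))"

definition equivalent_extensions :: "(complex \<Rightarrow> real^3) \<Rightarrow> (complex \<Rightarrow> real^3) \<Rightarrow> bool" where
  "equivalent_extensions F1 F2 \<longleftrightarrow>
     (\<exists>\<phi>. diffeomorphism D2 D2 \<phi> \<and> orientation_preserving_disc \<phi> \<and>
          (\<forall>z\<in>S1. \<phi> z = z) \<and> (\<forall>z\<in>D2. F1 z = F2 (\<phi> z)))"


section \<open>Numberings and rays\<close>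

abbreviation regions :: "(complex \<Rightarrow> real^3) \<Rightarrow> (real^3) set set" where
  "regions f \<equiv> components (S2 - f ` S1)"

text \<open>The region \<open>X\<close> contains all points of the sphere obtained by pushing \<open>f z\<close> slightly to the left
  (right) of the curve.  If \<open>f z\<close> is not a double point, exactly one region lies on either side.\<close>

definition left_region :: "(complex \<Rightarrow> real^3) \<Rightarrow> complex \<Rightarrow> (real^3) set \<Rightarrow> bool" where
  "left_region f z X \<longleftrightarrow>
     (\<forall>\<^sub>F h in at_right 0. sgn (f z + h *\<^sub>R cross3 (f z) (velocity f z)) \<in> X)"

definition right_region :: "(complex \<Rightarrow> real^3) \<Rightarrow> complex \<Rightarrow> (real^3) set \<Rightarrow> bool" where
  "right_region f z X \<longleftrightarrow>
     (\<forall>\<^sub>F h in at_right 0. sgn (f z - h *\<^sub>R cross3 (f z) (velocity f z)) \<in> X)"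

text \<open>Two regions share a boundary segment iff they lie on the two sides of the curve at some point
  which is not a double point.\<close>

definition numbering :: "(complex \<Rightarrow> real^3) \<Rightarrow> ((real^3) set \<Rightarrow> int) \<Rightarrow> bool" where
  "numbering f \<psi> \<longleftrightarrow>
     (\<forall>X\<in>regions f. \<forall>Y\<in>regions f. \<forall>z\<in>S1.
        \<not> double_point f (f z) \<and> right_region f z X \<and> left_region f z Y \<longrightarrow> \<psi> Y = \<psi> X + 1)"

definition base_region ::
  "(complex \<Rightarrow> real^3) \<Rightarrow> ((real^3) set \<Rightarrow> int) \<Rightarrow> (real^3) set \<Rightarrow> bool" where
  "base_region f \<psi> X0 \<longleftrightarrow> X0 \<in> regions f \<and> (\<forall>X\<in>regions f. \<psi> X0 \<le> \<psi> X)"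

definition ray_velocity :: "(real \<Rightarrow> real^3) \<Rightarrow> real \<Rightarrow> real^3" where
  "ray_velocity r u = vector_derivative r (at u within {0..1})"

definition ray :: "(complex \<Rightarrow> real^3) \<Rightarrow> real^3 \<Rightarrow> real^3 \<Rightarrow> (real \<Rightarrow> real^3) \<Rightarrow> bool" where
  "ray f p x0 r \<longleftrightarrow>
     arc r \<and> regular_on {0..1} r \<and> path_image r \<subseteq> S2 \<and> pathstart r = p \<and> pathfinish r = x0 \<and>
     (\<forall>q\<in>path_image r. \<not> double_point f q) \<and>
     (\<forall>u\<in>{0..1}. \<forall>z\<in>S1. r u = f z \<longrightarrow> cross3 (ray_velocity r u) (velocity f z) \<noteq> 0)"

text \<open>Rays are indexed by the regions different from the base region; the ray \<open>c X\<close> starts at the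
  chosen point \<open>pathstart (c X)\<close> of \<open>X\<close>.\<close>

definition ray_system ::
  "(complex \<Rightarrow> real^3) \<Rightarrow> (real^3) set \<Rightarrow> real^3 \<Rightarrow> ((real^3) set \<Rightarrow> real \<Rightarrow> real^3) \<Rightarrow> bool" where
  "ray_system f X0 x0 c \<longleftrightarrow>
     (\<forall>X\<in>regions f - {X0}.
        pathstart (c X) \<in> X \<and> ray f (pathstart (c X)) x0 (c X) \<and>
        (\<forall>r. ray f (pathstart (c X)) x0 r \<longrightarrow>
           card (path_image (c X) \<inter> f ` S1) \<le> card (path_image r \<inter> f ` S1))) \<and>
     (\<forall>X\<in>regions f - {X0}. \<forall>Y\<in>regions f - {X0}.
        X \<noteq> Y \<longrightarrow> path_image (c X) \<inter> path_image (c Y) = {x0})"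


section \<open>Words\<close>

text \<open>The letter \<open>(i, True)\<close> stands for \<open>a\<^sub>i\<close> and \<open>(i, False)\<close> for its inverse.\<close>

type_synonym 'i letter = "'i \<times> bool"

definition inv_letter :: "'i letter \<Rightarrow> 'i letter" where
  "inv_letter a = (fst a, \<not> snd a)"

definition reduced_word :: "'i letter list \<Rightarrow> bool" where
  "reduced_word w \<longleftrightarrow>
     successively (\<lambda>a b. b \<noteq> inv_letter a) w \<and> (w \<noteq> [] \<longrightarrow> last w \<noteq> inv_letter (hd w))"

definition positive_word :: "'i letter list \<Rightarrow> bool" where
  "positive_word w \<longleftrightarrow> (\<forall>a\<in>set w. snd a) \<and> distinct_adj w"

definition pairing :: "'i letter list \<Rightarrow> bool" where
  "pairing v \<longleftrightarrow> (\<exists>a p. positive_word p \<and> v = a # p @ [inv_letter a])"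

definition negative_group :: "'i letter list \<Rightarrow> bool" where
  "negative_group v \<longleftrightarrow> (\<exists>i j. i \<noteq> j \<and> v = [(j, False), (i, False)])"

text \<open>\<open>cancellation w P\<close>: the numbered word \<open>w\<close> can be turned into a positive word by successively
  cancelling pairings and negative groups, and \<open>P\<close> collects the pairs of numbers of the first and
  the last letter of each cancelled subword.\<close>

inductive cancellation :: "(nat \<times> 'i letter) list \<Rightarrow> (nat \<times> nat) set \<Rightarrow> bool" where
  positive: "positive_word (map snd w) \<Longrightarrow> cancellation w {}"
| cancel: "pairing (map snd v) \<or> negative_group (map snd v) \<Longrightarrow> cancellation (x1 @ x2) P \<Longrightarrow>
     cancellation (x1 @ v @ x2) (insert (fst (hd v), fst (last v)) P)"

text \<open>Parameters in \<open>[0, 2\<pi>)\<close> of the intersections of the curve with the rays, in the order in which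
  they are met on a walk from the initial point \<open>s\<close> of the circle.\<close>

definition crossing_params ::
  "(complex \<Rightarrow> real^3) \<Rightarrow> (real^3) set \<Rightarrow> ((real^3) set \<Rightarrow> real \<Rightarrow> real^3) \<Rightarrow> complex \<Rightarrow> real list"
  where
  "crossing_params f X0 c s =
     sorted_list_of_set
       {t \<in> {0..<2 * pi}. \<exists>X\<in>regions f - {X0}. f (s * cis t) \<in> path_image (c X)}"

definition ray_at ::
  "(complex \<Rightarrow> real^3) \<Rightarrow> (real^3) set \<Rightarrow> ((real^3) set \<Rightarrow> real \<Rightarrow> real^3) \<Rightarrow> complex \<Rightarrow> (real^3) set"
  where
  "ray_at f X0 c z = (THE X. X \<in> regions f - {X0} \<and> f z \<in> path_image (c X))"

definition ray_time :: "(complex \<Rightarrow> real^3) \<Rightarrow> (real \<Rightarrow> real^3) \<Rightarrow> complex \<Rightarrow> real" where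
  "ray_time f r z = the_inv_into {0..1} r (f z)"

text \<open>The sign is positive iff the ray crosses the curve from its left to its right.\<close>

definition letter_at ::
  "(complex \<Rightarrow> real^3) \<Rightarrow> (real^3) set \<Rightarrow> ((real^3) set \<Rightarrow> real \<Rightarrow> real^3) \<Rightarrow> complex \<Rightarrow>
   (real^3) set letter" where
  "letter_at f X0 c z =
     (let X = ray_at f X0 c z
      in (X, ray_velocity (c X) (ray_time f (c X) z) \<bullet> cross3 (f z) (velocity f z) < 0))"

definition word ::
  "(complex \<Rightarrow> real^3) \<Rightarrow> (real^3) set \<Rightarrow> ((real^3) set \<Rightarrow> real \<Rightarrow> real^3) \<Rightarrow> complex \<Rightarrow>
   (real^3) set letter list" where
  "word f X0 c s = map (\<lambda>t. letter_at f X0 c (s * cis t)) (crossing_params f X0 c s)"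

text \<open>The preimage on the circle of the letter with number \<open>k\<close>; numbers start at 0.\<close>

definition mark ::
  "(complex \<Rightarrow> real^3) \<Rightarrow> (real^3) set \<Rightarrow> ((real^3) set \<Rightarrow> real \<Rightarrow> real^3) \<Rightarrow> complex \<Rightarrow> nat \<Rightarrow> complex"
  where
  "mark f X0 c s k = s * cis (crossing_params f X0 c s ! k)"


section \<open>Intervals, weighted trees and groupings\<close>

text \<open>An interval may have one corner: its image for a negative group runs into the base
  point along one ray and leaves it along another one, usually at an angle.  Being transverse to the
  circle, it meets the circle only in its end points.\<close>

definition disc_interval :: "complex \<Rightarrow> complex \<Rightarrow> (real \<Rightarrow> complex) \<Rightarrow> bool" where
  "disc_interval z w \<gamma> \<longleftrightarrow>
     arc \<gamma> \<and> pathstart \<gamma> = z \<and> pathfinish \<gamma> = w \<and>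
     (\<exists>b\<in>{0<..<1}. regular_on {0..b} \<gamma> \<and> regular_on {b..1} \<gamma>) \<and>
     (\<forall>t\<in>{0<..<1}. \<gamma> t \<in> ball 0 1) \<and>
     vector_derivative \<gamma> (at 0 within {0..1}) \<bullet> z \<noteq> 0 \<and>
     vector_derivative \<gamma> (at 1 within {0..1}) \<bullet> w \<noteq> 0"

definition interval_system ::
  "(nat \<Rightarrow> complex) \<Rightarrow> (nat \<times> nat) set \<Rightarrow> (nat \<times> nat \<Rightarrow> real \<Rightarrow> complex) \<Rightarrow> bool" where
  "interval_system m P \<gamma> \<longleftrightarrow>
     (\<forall>(k, l)\<in>P. m k \<in> S1 \<and> m l \<in> S1 \<and> disc_interval (m k) (m l) (\<gamma> (k, l))) \<and>
     pairwise (\<lambda>e e'. disjnt (path_image (\<gamma> e)) (path_image (\<gamma> e'))) P"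

definition small_discs ::
  "(nat \<times> nat) set \<Rightarrow> (nat \<times> nat \<Rightarrow> real \<Rightarrow> complex) \<Rightarrow> complex set set" where
  "small_discs P \<gamma> = closure ` components (D2 - (\<Union>e\<in>P. path_image (\<gamma> e)))"

text \<open>Vertices, and edges given by their end points together with their label.\<close>

type_synonym 'v wtree = "'v set \<times> ('v set \<times> nat set) set"

definition wtree_iso :: "'v wtree \<Rightarrow> 'u wtree \<Rightarrow> bool" where
  "wtree_iso T U \<longleftrightarrow>
     (\<exists>h. bij_betw h (fst T) (fst U) \<and> (\<lambda>(e, lab). (h ` e, lab)) ` snd T = snd U)"

text \<open>The two small discs adjacent to an interval are those whose closure contains it.\<close>

definition interval_tree ::
  "(nat \<times> nat) set \<Rightarrow> (nat \<times> nat \<Rightarrow> real \<Rightarrow> complex) \<Rightarrow> complex set wtree" where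
  "interval_tree P \<gamma> =
     (small_discs P \<gamma>,
      (\<lambda>(k, l). ({C \<in> small_discs P \<gamma>. path_image (\<gamma> (k, l)) \<subseteq> C}, {k, l})) ` P)"

definition grouping ::
  "(complex \<Rightarrow> real^3) \<Rightarrow> (real^3) set \<Rightarrow> ((real^3) set \<Rightarrow> real \<Rightarrow> real^3) \<Rightarrow> complex \<Rightarrow>
   complex set wtree \<Rightarrow> bool" where
  "grouping f X0 c s G \<longleftrightarrow>
     (\<exists>P \<gamma>. cancellation (List.enumerate 0 (word f X0 c s)) P \<and>
            interval_system (mark f X0 c s) P \<gamma> \<and> G = interval_tree P \<gamma>)"

text \<open>The path between the intersection points \<open>f z\<close> and \<open>f w\<close>: part of a single ray for a pairing,
  and two legs meeting at the base point for a negative group.\<close>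

definition ray_path ::
  "(complex \<Rightarrow> real^3) \<Rightarrow> (real^3) set \<Rightarrow> ((real^3) set \<Rightarrow> real \<Rightarrow> real^3) \<Rightarrow> complex \<Rightarrow> complex \<Rightarrow>
   (real^3) set" where
  "ray_path f X0 c z w =
     (let X = ray_at f X0 c z; Y = ray_at f X0 c w
      in if X = Y then c X ` closed_segment (ray_time f (c X) z) (ray_time f (c X) w)
         else c X ` {ray_time f (c X) z..1} \<union> c Y ` {ray_time f (c Y) w..1})"

definition induced_by ::
  "(complex \<Rightarrow> real^3) \<Rightarrow> (real^3) set \<Rightarrow> ((real^3) set \<Rightarrow> real \<Rightarrow> real^3) \<Rightarrow> complex \<Rightarrow>
   complex set wtree \<Rightarrow> (complex \<Rightarrow> real^3) \<Rightarrow> bool" where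
  "induced_by f X0 c s G F \<longleftrightarrow>
     (\<exists>P \<gamma>. cancellation (List.enumerate 0 (word f X0 c s)) P \<and>
        interval_system (mark f X0 c s) P \<gamma> \<and>
        wtree_iso (interval_tree P \<gamma>) G \<and>
        (\<forall>(k, l)\<in>P. diffeomorphism (path_image (\<gamma> (k, l)))
           (ray_path f X0 c (mark f X0 c s k) (mark f X0 c s l)) F) \<and>
        (\<forall>C\<in>small_discs P \<gamma>. \<exists>g. homeomorphism C (F ` C) F g))"

end

theory Submission
  imports Defs
begin

text \<open>
  Every cancelled subword contains a letter with exponent \<open>-1\<close>, and every such letter is cancelled.
  At a negative letter the ray crosses the curve from right to left, so, as the surface lies to the left,
  the interval starting there is the lift of the ray in the direction of \<open>x0\<close>, up to its first return
  to the circle or up to \<open>x0\<close>. Hence every interval is a union of such lifts. Immersions of the disc are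
  locally injective, so these lifts are unique, and a diffeomorphism \<open>\<phi>\<close> with \<open>F1 = F2 \<circ> \<phi>\<close> that fixes
  the circle carries the intervals of \<open>F1\<close> onto the intervals of \<open>F2\<close> with the same end points.
  It then carries the small discs of \<open>F1\<close> onto those of \<open>F2\<close>, which is an isomorphism of the trees.
\<close>


section \<open>Unique lifting through immersed discs\<close>

lemma norm_sgn_scaleR: "norm u *\<^sub>R sgn u = u"
  by (cases "u = 0") (simp_all add: sgn_div_norm)

text \<open>At a boundary point only directions pointing into the disc can be tested. The segments
  from \<open>z\<close> to points \<open>u\<close> of the disc determine the derivative on all
  vectors \<open>u - z\<close>, and these span the plane.\<close>

lemma has_derivative_unique_within_disc:
  assumes L: "(F has_derivative L) (at z within D2)"
    and M: "(F has_derivative M) (at z within D2)"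
    and z: "z \<in> D2"
  shows "L = (M :: complex \<Rightarrow> 'b::euclidean_space)"
proof -
  have 1: "((\<lambda>t. F (z + t *\<^sub>R (u - z))) has_vector_derivative K (u - z)) (at 0 within cbox 0 1)"
    if K: "(F has_derivative K) (at z within D2)" and u: "u \<in> D2" for K and u
  proof -
    let ?p = "\<lambda>t::real. z + t *\<^sub>R (u - z)"
    have "?p ` cbox 0 1 \<subseteq> D2"
    proof (rule image_subsetI)
      fix t :: real assume "t \<in> cbox 0 1"
      then have "(1 - t) *\<^sub>R z + t *\<^sub>R u \<in> D2"
        using convexD_alt[OF convex_cball z u] by auto
      then show "?p t \<in> D2" by (simp add: algebra_simps)
    qed
    then have "(F has_derivative K) (at (?p 0) within ?p ` cbox 0 1)"
      using has_derivative_subset[OF K] by simp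
    moreover have "(?p has_derivative (\<lambda>t. t *\<^sub>R (u - z))) (at 0 within cbox 0 1)"
      by (auto intro!: derivative_eq_intros)
    ultimately have "((\<lambda>t. F (?p t)) has_derivative (\<lambda>t. K (t *\<^sub>R (u - z)))) (at 0 within cbox 0 1)"
      using has_derivative_in_compose by blast
    then show ?thesis
      using linear_scale[OF has_derivative_linear[OF K]]
      by (simp add: has_vector_derivative_def)
  qed
  have 2: "L (u - z) = M (u - z)" if u: "u \<in> D2" for u
    by (rule vector_derivative_unique_within_closed_interval[OF _ _ 1[OF L u] 1[OF M u]]) auto
  have lin: "linear (\<lambda>x. L x - M x)"
    using L M by (intro linear_compose_sub has_derivative_linear)
  \<comment> \<open>The difference of the derivatives vanishes at \<open>u - z\<close> and at
    \<open>0 - z\<close>, hence at \<open>u\<close>; scaling unit vectors then reaches every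
    vector.\<close>
  have 3: "L u - M u = 0" if u: "u \<in> D2" for u
    using 2[OF u] 2[of 0] linear_diff[OF lin, of u z] linear_diff[OF lin, of 0 z] linear_0[OF lin] by simp
  show ?thesis
  proof
    fix u
    have "L (sgn u) - M (sgn u) = 0" by (intro 3) (simp add: norm_sgn)
    then have "norm u *\<^sub>R (L (sgn u) - M (sgn u)) = 0" by simp
    then show "L u = M u"
      using linear_scale[OF lin, of "norm u" "sgn u"] by (simp only: norm_sgn_scaleR) simp
  qed
qed

text \<open>With this bound on the basis \<open>1\<close>, \<open>\<i>\<close>, continuity of
  \<open>h' x v\<close> for each fixed \<open>v\<close> becomes continuity of \<open>h' x\<close> in
  operator norm.\<close>

lemma onorm_complex_le:
  fixes L :: "complex \<Rightarrow> 'b::real_normed_vector"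
  assumes "linear L"
  shows "onorm L \<le> norm (L 1) + norm (L \<i>)"
proof (rule onorm_le)
  fix w :: complex
  have "w = Re w *\<^sub>R 1 + Im w *\<^sub>R \<i>" by (simp add: complex_eq_iff)
  then have "L w = Re w *\<^sub>R L 1 + Im w *\<^sub>R L \<i>"
    by (metis assms linear_add linear_scale)
  then have "norm (L w) \<le> \<bar>Re w\<bar> * norm (L 1) + \<bar>Im w\<bar> * norm (L \<i>)"
    by (metis norm_scaleR norm_triangle_ineq)
  also have "\<dots> \<le> norm w * norm (L 1) + norm w * norm (L \<i>)"
    by (intro add_mono mult_right_mono abs_Re_le_cmod abs_Im_le_cmod) auto
  finally show "norm (L w) \<le> (norm (L 1) + norm (L \<i>)) * norm w"
    by (simp add: algebra_simps)
qed

text \<open>An injective derivative gives local injectivity on an open set, so the argument runs on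
  a smooth local extension \<open>h\<close> of \<open>F\<close>. By uniqueness the derivative of
  \<open>h\<close> at \<open>z\<close> is that of \<open>F\<close>, even on the boundary.\<close>

lemma immersed_disc_locally_injective:
  assumes F: "immersed_disc F" and z: "z \<in> D2"
  obtains r where "r > 0" "inj_on F (D2 \<inter> ball z r)"
proof -
  obtain U h where U: "open U" "z \<in> U" and h: "\<And>k. Ck_on k h U" and eq: "\<And>y. y \<in> D2 \<inter> U \<Longrightarrow> h y = F y"
    using F z unfolding immersed_disc_def smooth_on_def by meson
  obtain h' where h': "\<And>x. x \<in> U \<Longrightarrow> (h has_derivative h' x) (at x)"
    and cont: "\<And>v. continuous_on U (\<lambda>x. h' x v)"
    using h[of "Suc 0"] by auto
  obtain L where L: "(F has_derivative L) (at z within D2)" "inj L"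
    using F z unfolding immersed_disc_def by blast
  have "(F has_derivative h' z) (at z within D2)"
  proof -
    obtain d where "d > 0" "ball z d \<subseteq> U" using U openE by blast
    moreover have "(h has_derivative h' z) (at z within D2)"
      using h'[OF U(2)] has_derivative_at_withinI by blast
    moreover have "h y = F y" if "y \<in> D2" "dist y z < d" for y
    proof (rule eq)
      have "y \<in> ball z d" using that by (simp add: dist_commute)
      then show "y \<in> D2 \<inter> U" using that calculation(2) by blast
    qed
    ultimately show ?thesis
      using z by (intro has_derivative_transform_within[of h "h' z" z D2 d F]) auto
  qed
  then have L': "h' z = L"
    using has_derivative_unique_within_disc L(1) z by blast
  have linL: "linear L" using L(1) by (rule has_derivative_linear)
  obtain g where g: "linear g" "g \<circ> L = id"
    using linear_injective_left_inverse[OF linL L(2)] by blast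
  \<comment> \<open>\<open>Ck_on\<close> controls \<open>h'\<close> one direction at a time; errors
    below \<open>e / 2\<close> on \<open>1\<close> and on \<open>\<i>\<close> add up to less than
    \<open>e\<close> in operator norm.\<close>
  have small: "\<exists>d>0. \<forall>x. dist z x < d \<longrightarrow> onorm (\<lambda>v. h' x v - h' z v) < e" if e: "e > 0" for e
  proof -
    have "\<forall>\<^sub>F x in at z. norm (h' x v - h' z v) < e / 2" for v
    proof -
      have "isCont (\<lambda>x. h' x v) z"
        using cont[of v] U continuous_on_eq_continuous_at by blast
      then show ?thesis
        using e half_gt_zero[OF e] unfolding isCont_def tendsto_iff dist_norm by blast
    qed
    from this[of 1] this[of \<i>]
    have ev: "\<forall>\<^sub>F x in at z. x \<in> U \<and> norm (h' x 1 - h' z 1) < e / 2 \<and> norm (h' x \<i> - h' z \<i>) < e / 2"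
      using eventually_at_in_open'[OF U] by eventually_elim auto
    then obtain d where d: "d > 0"
      "\<And>x. x \<noteq> z \<Longrightarrow> dist x z < d \<Longrightarrow> x \<in> U \<and> norm (h' x 1 - h' z 1) < e / 2 \<and> norm (h' x \<i> - h' z \<i>) < e / 2"
      unfolding eventually_at by auto
    show ?thesis
    proof (intro exI conjI allI impI)
      show "d > 0" by fact
      fix x assume x: "dist z x < d"
      show "onorm (\<lambda>v. h' x v - h' z v) < e"
      proof (cases "x = z")
        case True
        then show ?thesis using e by (simp add: onorm_zero)
      next
        case False
        with d(2)[of x] x have *: "x \<in> U" "norm (h' x 1 - h' z 1) < e / 2" "norm (h' x \<i> - h' z \<i>) < e / 2"
          by (auto simp: dist_commute)
        have "onorm (\<lambda>v. h' x v - h' z v) \<le> norm (h' x 1 - h' z 1) + norm (h' x \<i> - h' z \<i>)"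
          using *(1) U h' by (intro onorm_complex_le linear_compose_sub has_derivative_linear) auto
        with * show ?thesis by simp
      qed
    qed
  qed
  obtain r where r: "r > 0" "ball z r \<subseteq> U" "inj_on h (ball z r)"
    by (rule has_derivative_locally_injective[OF U(2,1) linear_conv_bounded_linear[THEN iffD1, OF g(1)], of h' h])
      (use g L' h' small in auto)
  show thesis
  proof
    show "inj_on F (D2 \<inter> ball z r)"
      using r(2,3) eq unfolding inj_on_def by (metis IntD1 IntD2 IntI subsetD)
  qed fact
qed

text \<open>The set where two lifts agree is open by local injectivity of \<open>F\<close> and
  closed because the plane is Hausdorff.\<close>

lemma immersed_disc_lift_unique:
  assumes F: "immersed_disc F" and S: "connected S" "t0 \<in> S" "t \<in> S"
    and \<alpha>: "continuous_on S \<alpha>" "\<alpha> ` S \<subseteq> D2" and \<beta>: "continuous_on S \<beta>" "\<beta> ` S \<subseteq> D2"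
    and eq: "\<And>t. t \<in> S \<Longrightarrow> F (\<alpha> t) = F (\<beta> t)" and t0: "\<alpha> t0 = \<beta> t0"
  shows "\<alpha> t = \<beta> t"
proof (rule connected_induction_simple[OF S(1), where P = "\<lambda>t. \<alpha> t = \<beta> t" and a = t0])
  fix a assume a: "a \<in> S"
  \<comment> \<open>Where the values lie in \<open>A\<close> and \<open>B\<close>, the lifts agree
    everywhere or nowhere: a ball of injectivity serves at a point of agreement, disjoint
    neighbourhoods serve elsewhere.\<close>
  obtain A B where AB: "openin (top_of_set S) {x \<in> S. \<alpha> x \<in> A}" "openin (top_of_set S) {x \<in> S. \<beta> x \<in> B}"
    "\<alpha> a \<in> A" "\<beta> a \<in> B"
    "(\<forall>x\<in>S. \<alpha> x \<in> A \<and> \<beta> x \<in> B \<longrightarrow> \<alpha> x = \<beta> x) \<or> (\<forall>x\<in>S. \<alpha> x \<in> A \<and> \<beta> x \<in> B \<longrightarrow> \<alpha> x \<noteq> \<beta> x)"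
  proof (cases "\<alpha> a = \<beta> a")
    case True
    obtain r where r: "r > 0" "inj_on F (D2 \<inter> ball (\<alpha> a) r)"
      using immersed_disc_locally_injective[OF F] \<alpha>(2) a by blast
    show thesis
    proof (rule that[of "ball (\<alpha> a) r" "ball (\<alpha> a) r"])
      show "(\<forall>x\<in>S. \<alpha> x \<in> ball (\<alpha> a) r \<and> \<beta> x \<in> ball (\<alpha> a) r \<longrightarrow> \<alpha> x = \<beta> x) \<or>
        (\<forall>x\<in>S. \<alpha> x \<in> ball (\<alpha> a) r \<and> \<beta> x \<in> ball (\<alpha> a) r \<longrightarrow> \<alpha> x \<noteq> \<beta> x)"
        using inj_onD[OF r(2) eq] \<alpha>(2) \<beta>(2) by (meson IntI image_subset_iff)
    qed (use r True continuous_openin_preimage_gen[OF \<alpha>(1), of "ball (\<alpha> a) r"]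
          continuous_openin_preimage_gen[OF \<beta>(1), of "ball (\<alpha> a) r"] in \<open>auto simp: vimage_def Collect_conj_eq\<close>)
  next
    case False
    then obtain A B where o: "open A" "open B" "\<alpha> a \<in> A" "\<beta> a \<in> B" "A \<inter> B = {}"
      using hausdorff by metis
    show thesis
    proof (rule that[of A B])
    qed (use o continuous_openin_preimage_gen[OF \<alpha>(1), of A]
          continuous_openin_preimage_gen[OF \<beta>(1), of B] in \<open>auto simp: vimage_def Collect_conj_eq\<close>)
  qed
  show "\<exists>T. openin (top_of_set S) T \<and> a \<in> T \<and> (\<forall>x\<in>T. \<forall>y\<in>T. \<alpha> x = \<beta> x \<longrightarrow> \<alpha> y = \<beta> y)"
    by (rule exI[of _ "{x \<in> S. \<alpha> x \<in> A} \<inter> {x \<in> S. \<beta> x \<in> B}"]) (use AB a openin_Int in auto)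
qed (use S t0 in auto)

section \<open>Lifts ending on the boundary circle\<close>

text \<open>In the basis \<open>- z\<close>, \<open>\<i> * z\<close> the vector \<open>y - z\<close>
  has coefficient \<open>1 - y \<bullet> z \<ge> 0\<close> along the inward normal; the tangential
  part is killed by \<open>tangent\<close>.\<close>

lemma inward_component_nonneg:
  assumes z: "z \<in> S1" and y: "y \<in> D2" and L: "linear L"
    and inward: "0 \<le> L (- z) \<bullet> N" and tangent: "L (\<i> * z) \<bullet> N = 0"
  shows "0 \<le> L (y - z) \<bullet> (N :: 'b::real_inner)"
proof -
  define w where "w = y - z"
  have zz: "Re z * Re z + Im z * Im z = 1"
    using z by (metis cmod_power2 mem_sphere_0 one_power2 power2_eq_square)
  \<comment> \<open>Multiplying by \<open>z * cnj z = 1\<close> produces the coordinates of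
    \<open>w\<close> in this basis.\<close>
  have "w = w * (z * cnj z)"
    using zz by (simp add: complex_eq_iff)
  also have "\<dots> = (- (w \<bullet> z)) *\<^sub>R (- z) + Im (w * cnj z) *\<^sub>R (\<i> * z)"
    by (simp add: complex_eq_iff inner_complex_def algebra_simps)
  finally have "L w = L ((- (w \<bullet> z)) *\<^sub>R (- z) + Im (w * cnj z) *\<^sub>R (\<i> * z))"
    by (rule arg_cong)
  then have "L w = (- (w \<bullet> z)) *\<^sub>R L (- z) + Im (w * cnj z) *\<^sub>R L (\<i> * z)"
    by (simp only: linear_add[OF L] linear_scale[OF L])
  then have "L w \<bullet> N = (- (w \<bullet> z)) * (L (- z) \<bullet> N)"
    using tangent by (simp add: inner_add_left del: mult_minus_left mult_minus_right minus_mult_minus scaleR_minus_left)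
  moreover have "y \<bullet> z \<le> norm y * norm z" by (rule norm_cauchy_schwarz)
  then have "y \<bullet> z \<le> 1" using y z by simp
  moreover have "z \<bullet> z = 1" using zz by (simp add: inner_complex_def)
  ultimately show ?thesis
    using inward by (simp add: w_def inner_diff_left mult_nonneg_nonneg)
qed

text \<open>To first order \<open>F\<close> maps the disc at \<open>z\<close> to the side of
  nonnegative inner product with \<open>N\<close>. If \<open>v \<bullet> N\<close> were positive,
  \<open>r\<close> would be on the other side just before \<open>u\<close>, where its lift cannot
  go.\<close>

lemma no_backward_lift:
  assumes z: "z \<in> S1" and dF: "(F has_derivative L) (at z within D2)"
    and inward: "0 < L (- z) \<bullet> N" and tangent: "L (\<i> * z) \<bullet> N = 0" and inj: "inj L"
    and bu: "b < u" and \<alpha>: "continuous_on {b..u} \<alpha>" "\<alpha> ` {b..u} \<subseteq> D2" "\<alpha> u = z"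
    and lift: "\<And>t. t \<in> {b..u} \<Longrightarrow> F (\<alpha> t) = r t"
    and dr: "(r has_vector_derivative v) (at u within {b..u})"
  shows "v \<bullet> (N :: 'b::euclidean_space) \<le> 0"
proof (rule ccontr)
  assume "\<not> v \<bullet> N \<le> 0"
  then have vN: "v \<bullet> N > 0" by simp
  have linL: "linear L" using dF by (rule has_derivative_linear)
  obtain B where B: "B > 0" "\<And>x. B * norm x \<le> norm (L x)"
    using linear_inj_bounded_below_pos[OF linL inj] by blast
  \<comment> \<open>\<open>K\<close> will bound \<open>norm (\<alpha> t - z)\<close> in units of
    \<open>u - t\<close>.\<close>
  define K where "K = (2 / B) * (norm v + 1)"
  have K: "K \<ge> 0" unfolding K_def using B by simp
  \<comment> \<open>In turn: the error of \<open>F\<close> is absorbed by the lower bound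
    \<open>B\<close> on \<open>L\<close>, the error of \<open>r\<close> is at most
    \<open>u - t\<close>, and the total error is at most half of
    \<open>(u - t) * (v \<bullet> N)\<close>.\<close>
  define e where "e = Min {B / 2, 1, v \<bullet> N / (2 * (norm N * (1 + K) + 1))}"
  have pos: "norm N * (1 + K) + 1 > 0" using K by (simp add: add_nonneg_pos)
  have e: "e \<le> B / 2" "e \<le> 1" "e \<le> v \<bullet> N / (2 * (norm N * (1 + K) + 1))" "e > 0"
    unfolding e_def by (rule Min_le; simp)+ (use B vN pos in simp)
  obtain d1 where d1: "d1 > 0"
    "\<And>y. y \<in> D2 \<Longrightarrow> norm (y - z) < d1 \<Longrightarrow> norm (F y - F z - L (y - z)) \<le> e * norm (y - z)"
    using dF e(4) unfolding has_derivative_within_alt by blast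
  obtain d2 where d2: "d2 > 0"
    "\<And>t. t \<in> {b..u} \<Longrightarrow> norm (t - u) < d2 \<Longrightarrow> norm (r t - r u - (t - u) *\<^sub>R v) \<le> e * norm (t - u)"
    using dr e(4) unfolding has_vector_derivative_def has_derivative_within_alt by blast
  obtain d3 where d3: "d3 > 0" "\<And>t. t \<in> {b..u} \<Longrightarrow> dist t u < d3 \<Longrightarrow> dist (\<alpha> t) (\<alpha> u) < d1"
    using \<alpha>(1) bu d1(1) unfolding continuous_on_iff by (metis atLeastAtMost_iff less_eq_real_def order_refl)
  define t where "t = max b (u - min d2 d3 / 2)"
  have t: "t \<in> {b..u}" "t < u" "norm (t - u) < d2" "dist t u < d3"
    using bu d2(1) d3(1) by (auto simp: t_def dist_real_def max_def min_def)
  define w where "w = \<alpha> t - z"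
  have yD: "\<alpha> t \<in> D2" using \<alpha>(2) t(1) by blast
  have "norm (\<alpha> t - z) < d1" using d3(2)[OF t(1,4)] \<alpha>(3) by (simp add: dist_norm)
  from d1(2)[OF yD this] have E1: "norm (r t - r u - L w) \<le> e * norm w"
    using lift[OF t(1)] lift[of u] bu \<alpha>(3) by (simp add: w_def)
  have E2: "norm (r t - r u - (t - u) *\<^sub>R v) \<le> e * (u - t)"
    using d2(2)[OF t(1,3)] t(2) by simp
  \<comment> \<open>Injectivity of \<open>L\<close> enters here: the lift moves at most linearly in
    \<open>u - t\<close>, so the error of \<open>F\<close> is also small compared with
    \<open>u - t\<close>.\<close>
  have "B * norm w \<le> norm (L w)" by (rule B)
  also have "\<dots> \<le> norm (r t - r u) + norm (r t - r u - L w)"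
    by (metis norm_minus_commute norm_triangle_sub)
  also have "\<dots> \<le> norm (r t - r u) + B / 2 * norm w"
    using E1 mult_right_mono[OF e(1), of "norm w"] by simp
  finally have 1: "B / 2 * norm w \<le> norm (r t - r u)" by (simp add: algebra_simps)
  have "norm (r t - r u) \<le> norm ((t - u) *\<^sub>R v) + norm (r t - r u - (t - u) *\<^sub>R v)"
    by (rule norm_triangle_sub)
  also have "\<dots> \<le> (u - t) * norm v + 1 * (u - t)"
    using order_trans[OF E2 mult_right_mono[OF e(2), of "u - t"]] t(2) by simp
  finally have "B / 2 * norm w \<le> (u - t) * (norm v + 1)"
    using 1 by (simp add: algebra_simps)
  then have nw: "norm w \<le> K * (u - t)"
    using B(1) by (simp add: K_def field_simps)
  have "0 \<le> L w \<bullet> N"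
    unfolding w_def using inward by (intro inward_component_nonneg[OF z yD linL _ tangent]) simp
  also have "L w \<bullet> N = (t - u) * (v \<bullet> N) + (r t - r u - (t - u) *\<^sub>R v) \<bullet> N - (r t - r u - L w) \<bullet> N"
    by (simp add: inner_diff_left)
  also have "\<dots> \<le> (t - u) * (v \<bullet> N) + norm (r t - r u - (t - u) *\<^sub>R v) * norm N + norm (r t - r u - L w) * norm N"
    using norm_cauchy_schwarz[of "r t - r u - (t - u) *\<^sub>R v" N] Cauchy_Schwarz_ineq2[of "r t - r u - L w" N]
    by linarith
  also have "\<dots> \<le> (t - u) * (v \<bullet> N) + (e * (u - t)) * norm N + (e * (K * (u - t))) * norm N"
    using E2 order_trans[OF E1 mult_left_mono[OF nw, of e]] e(4)
    by (intro add_mono mult_right_mono[of _ _ "norm N"] order_refl) auto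
  also have "\<dots> = (u - t) * (e * (norm N * (1 + K)) - v \<bullet> N)" by (simp add: algebra_simps)
  finally have "0 \<le> e * (norm N * (1 + K)) - v \<bullet> N"
    using t(2) by (simp add: zero_le_mult_iff)
  moreover have "e * (norm N * (1 + K) + 1) \<le> v \<bullet> N / 2"
    using e(3) pos by (simp add: field_simps)
  moreover have "e * (norm N * (1 + K)) \<le> e * (norm N * (1 + K) + 1)"
    using e(4) by simp
  ultimately show False using vN by linarith
qed

section \<open>Trees and cancellations\<close>

lemma connected_component_homeomorphism_image_subset:
  assumes "homeomorphism S T \<phi> g" "x \<in> S"
  shows "\<phi> ` connected_component_set S x \<subseteq> connected_component_set T (\<phi> x)"
proof (rule connected_component_maximal)
  have S: "connected_component_set S x \<subseteq> S" by (rule connected_component_subset)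
  show "connected (\<phi> ` connected_component_set S x)"
    by (rule connected_continuous_image
        [OF continuous_on_subset[OF homeomorphism_cont1[OF assms(1)] S] connected_connected_component])
  show "\<phi> ` connected_component_set S x \<subseteq> T"
    using image_mono[OF S, of \<phi>] homeomorphism_image1[OF assms(1)] by simp
  show "\<phi> x \<in> \<phi> ` connected_component_set S x"
    using assms(2) by simp
qed

lemma connected_component_homeomorphism_image:
  assumes "homeomorphism S T \<phi> g" "x \<in> S"
  shows "connected_component_set T (\<phi> x) = \<phi> ` connected_component_set S x"
proof
  have x: "\<phi> x \<in> T" "g (\<phi> x) = x"
    using assms homeomorphism_image1[OF assms(1)] homeomorphism_apply1[OF assms(1)] by auto
  show "connected_component_set T (\<phi> x) \<subseteq> \<phi> ` connected_component_set S x"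
  proof
    fix y assume y: "y \<in> connected_component_set T (\<phi> x)"
    have "g ` connected_component_set T (\<phi> x) \<subseteq> connected_component_set S (g (\<phi> x))"
      by (rule connected_component_homeomorphism_image_subset[OF homeomorphism_symD[OF assms(1)] x(1)])
    then have "g y \<in> connected_component_set S x"
      using y unfolding x(2) by blast
    moreover have "y \<in> T"
      by (rule subsetD[OF connected_component_subset y])
    then have "\<phi> (g y) = y" by (rule homeomorphism_apply2[OF assms(1)])
    ultimately show "y \<in> \<phi> ` connected_component_set S x" by (metis image_eqI)
  qed
qed (rule connected_component_homeomorphism_image_subset[OF assms])

lemma components_homeomorphism_image:
  assumes "homeomorphism S T \<phi> g"
  shows "components T = (`) \<phi> ` components S"
proof -
  have T: "T = \<phi> ` S" using assms by (simp add: homeomorphism_def)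
  have "components T = (\<lambda>x. connected_component_set T (\<phi> x)) ` S"
    unfolding components_def by (subst T) (simp add: image_image T)
  also have "\<dots> = (\<lambda>x. \<phi> ` connected_component_set S x) ` S"
    using connected_component_homeomorphism_image[OF assms] by (intro image_cong) auto
  finally show ?thesis by (simp add: components_def image_image)
qed

text \<open>The image of \<open>closure C\<close> is compact, hence closed; this gives the inclusion
  that fails for general continuous maps.\<close>

lemma closure_image_compact:
  fixes \<phi> :: "'a::euclidean_space \<Rightarrow> 'b::euclidean_space"
  assumes "compact K" "continuous_on K \<phi>" "C \<subseteq> K"
  shows "closure (\<phi> ` C) = \<phi> ` closure C"
proof
  have "closure C \<subseteq> K"
    using assms by (simp add: closure_minimal compact_imp_closed)
  then have *: "continuous_on (closure C) \<phi>" "compact (closure C)"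
    using assms continuous_on_subset compact_closure bounded_subset compact_imp_bounded by blast+
  then show "closure (\<phi> ` C) \<subseteq> \<phi> ` closure C"
    by (meson closure_minimal closure_subset compact_continuous_image compact_imp_closed image_mono)
  show "\<phi> ` closure C \<subseteq> closure (\<phi> ` C)"
    by (rule image_closure_subset[OF *(1)]) (auto simp: closure_subset)
qed

section \<open>Trees of small discs\<close>

lemma small_discs_subset:
  assumes "C \<in> small_discs P \<gamma>"
  shows "C \<subseteq> D2"
proof -
  obtain K where K: "K \<in> components (D2 - (\<Union>e\<in>P. path_image (\<gamma> e)))" "C = closure K"
    using assms unfolding small_discs_def by blast
  then have "K \<subseteq> D2" using in_components_subset[OF K(1)] by blast
  then show ?thesis unfolding K(2) by (rule closure_minimal) simp
qed

lemma small_discs_homeomorphism_image: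
  assumes \<phi>: "homeomorphism D2 D2 \<phi> g"
    and U: "(\<Union>e\<in>P. path_image (\<gamma> e)) \<subseteq> D2"
    and V: "\<phi> ` (\<Union>e\<in>P. path_image (\<gamma> e)) = (\<Union>e\<in>Q. path_image (\<delta> e))"
  shows "small_discs Q \<delta> = (`) \<phi> ` small_discs P \<gamma>"
proof -
  let ?A = "D2 - (\<Union>e\<in>P. path_image (\<gamma> e))" and ?B = "D2 - (\<Union>e\<in>Q. path_image (\<delta> e))"
  have inj: "inj_on \<phi> D2" and im: "\<phi> ` D2 = D2" and cont: "continuous_on D2 \<phi>"
    using \<phi> by (auto simp: homeomorphism_def intro: inj_on_inverseI)
  have "\<phi> ` ?A = ?B"
    using inj_on_image_set_diff[OF inj _ U, of D2] im V by simp
  then have "homeomorphism ?A ?B \<phi> g"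
    by (intro homeomorphism_of_subsets[OF \<phi>]) auto
  then have "small_discs Q \<delta> = (\<lambda>C. closure (\<phi> ` C)) ` components ?A"
    by (simp add: small_discs_def components_homeomorphism_image image_image)
  also have "\<dots> = (\<lambda>C. \<phi> ` closure C) ` components ?A"
    using in_components_subset
    by (intro image_cong refl closure_image_compact[OF compact_cball cont]) blast
  finally show ?thesis by (simp add: small_discs_def image_image)
qed

lemma interval_tree_eq:
  "interval_tree P \<gamma> = (small_discs P \<gamma>,
     (\<lambda>e. ({C \<in> small_discs P \<gamma>. path_image (\<gamma> e) \<subseteq> C}, {fst e, snd e})) ` P)"
  by (simp add: interval_tree_def case_prod_unfold)

text \<open>The vertex map sends a small disc to its image. Injectivity of \<open>\<phi>\<close>
  preserves and reflects containment of an interval in a small disc, so ends of edges correspond.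
  Labels are unordered, so \<open>e\<close> and \<open>e'\<close> may list their letters in
  different orders.\<close>

lemma interval_tree_iso:
  assumes \<phi>: "homeomorphism D2 D2 \<phi> g"
    and U: "\<And>e. e \<in> P \<Longrightarrow> path_image (\<gamma> e) \<subseteq> D2"
    and PQ: "\<And>e. e \<in> P \<Longrightarrow> \<exists>e'\<in>Q. \<phi> ` path_image (\<gamma> e) = path_image (\<delta> e') \<and> {fst e, snd e} = {fst e', snd e'}"
    and QP: "\<And>e'. e' \<in> Q \<Longrightarrow> \<exists>e\<in>P. \<phi> ` path_image (\<gamma> e) = path_image (\<delta> e') \<and> {fst e, snd e} = {fst e', snd e'}"
  shows "wtree_iso (interval_tree P \<gamma>) (interval_tree Q \<delta>)"
proof -
  let ?V = "small_discs P \<gamma>" and ?W = "small_discs Q \<delta>"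
  let ?E = "\<lambda>e. ({C \<in> ?V. path_image (\<gamma> e) \<subseteq> C}, {fst e, snd e})"
  let ?E' = "\<lambda>e. ({C \<in> ?W. path_image (\<delta> e) \<subseteq> C}, {fst e, snd e})"
  let ?h = "\<lambda>(E, lab :: nat set). ((`) \<phi> ` E :: complex set set, lab)"
  have inj: "inj_on \<phi> D2"
    using \<phi> by (auto simp: homeomorphism_def intro: inj_on_inverseI)
  have "\<phi> ` (\<Union>e\<in>P. path_image (\<gamma> e)) = (\<Union>e\<in>Q. path_image (\<delta> e))"
  proof -
    have "(\<lambda>e. \<phi> ` path_image (\<gamma> e)) ` P = (\<lambda>e. path_image (\<delta> e)) ` Q"
    proof (intro equalityI image_subsetI)
      fix e assume "e \<in> P"
      with PQ show "\<phi> ` path_image (\<gamma> e) \<in> (\<lambda>e. path_image (\<delta> e)) ` Q" by blast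
    next
      fix e' assume "e' \<in> Q"
      with QP obtain e where "e \<in> P" "\<phi> ` path_image (\<gamma> e) = path_image (\<delta> e')" by blast
      then show "path_image (\<delta> e') \<in> (\<lambda>e. \<phi> ` path_image (\<gamma> e)) ` P" by (metis image_eqI)
    qed
    then show ?thesis by (simp only: image_UN)
  qed
  then have W: "?W = (`) \<phi> ` ?V"
    using U by (intro small_discs_homeomorphism_image[OF \<phi>]) auto
  have bij: "bij_betw ((`) \<phi>) ?V ?W"
    unfolding bij_betw_def W
    using inj_on_subset[OF inj_on_image_Pow[OF inj], of ?V] small_discs_subset by blast
  have edge: "?h (?E e) = ?E' e'"
    if "e \<in> P" "\<phi> ` path_image (\<gamma> e) = path_image (\<delta> e')" "{fst e, snd e} = {fst e', snd e'}" for e e'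
  proof -
    have "path_image (\<gamma> e) \<subseteq> C \<longleftrightarrow> path_image (\<delta> e') \<subseteq> \<phi> ` C" if "C \<in> ?V" for C
      unfolding \<open>\<phi> ` path_image (\<gamma> e) = path_image (\<delta> e')\<close>[symmetric]
      using inj_on_image_subset_iff[OF inj U[OF \<open>e \<in> P\<close>] small_discs_subset[OF that]] by simp
    then show ?thesis using that(3) by (auto simp: W)
  qed
  have "?h ` ?E ` P = ?E' ` Q"
  proof
    show "?h ` ?E ` P \<subseteq> ?E' ` Q"
    proof (rule subsetI, elim imageE, hypsubst)
      fix e assume "e \<in> P"
      with PQ obtain e' where e': "e' \<in> Q" "\<phi> ` path_image (\<gamma> e) = path_image (\<delta> e')"
        "{fst e, snd e} = {fst e', snd e'}"
        by blast
      show "?h (?E e) \<in> ?E' ` Q"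
        unfolding edge[OF \<open>e \<in> P\<close> e'(2,3)] using e'(1) by (rule imageI)
    qed
    show "?E' ` Q \<subseteq> ?h ` ?E ` P"
    proof (rule image_subsetI)
      fix e' assume "e' \<in> Q"
      with QP obtain e where e: "e \<in> P" "\<phi> ` path_image (\<gamma> e) = path_image (\<delta> e')"
        "{fst e, snd e} = {fst e', snd e'}"
        by blast
      show "?E' e' \<in> ?h ` ?E ` P"
        unfolding edge[OF e, symmetric] by (intro imageI e(1))
    qed
  qed
  then show ?thesis
    unfolding wtree_iso_def interval_tree_eq fst_conv snd_conv using bij by blast
qed

text \<open>The inverse of \<open>h\<close> undoes \<open>h\<close> on vertices only, so
  \<open>wf\<close> keeps the ends of edges among the vertices.\<close>

lemma wtree_iso_sym:
  assumes "wtree_iso T U" and wf: "\<And>e lab. (e, lab) \<in> snd T \<Longrightarrow> e \<subseteq> fst T"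
  shows "wtree_iso U T"
proof -
  obtain h where h: "bij_betw h (fst T) (fst U)" "(\<lambda>(e, lab). (h ` e, lab)) ` snd T = snd U"
    using assms(1) unfolding wtree_iso_def by blast
  let ?g = "the_inv_into (fst T) h"
  have "(\<lambda>(e, lab). (?g ` e, lab)) ` snd U = (\<lambda>(e, lab). (?g ` h ` e, lab)) ` snd T"
    unfolding h(2)[symmetric] image_image[of _ _ "snd T"] by (simp add: case_prod_unfold)
  also have "\<dots> = id ` snd T"
  proof (rule image_cong)
    fix x assume "x \<in> snd T"
    moreover have "?g ` h ` e = e" if "e \<subseteq> fst T" for e
      using that the_inv_into_f_f[OF bij_betw_imp_inj_on[OF h(1)]] by force
    ultimately show "(\<lambda>(e, lab). (?g ` h ` e, lab)) x = id x"
      using wf by (cases x) auto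
  qed simp
  finally have "(\<lambda>(e, lab). (?g ` e, lab)) ` snd U = snd T" by simp
  with bij_betw_the_inv_into[OF h(1)] show ?thesis
    unfolding wtree_iso_def by blast
qed

lemma wtree_iso_trans:
  assumes "wtree_iso T U" "wtree_iso U V"
  shows "wtree_iso T V"
proof -
  obtain h where h: "bij_betw h (fst T) (fst U)" "(\<lambda>(e, lab). (h ` e, lab)) ` snd T = snd U"
    using assms(1) unfolding wtree_iso_def by blast
  obtain g where g: "bij_betw g (fst U) (fst V)" "(\<lambda>(e, lab). (g ` e, lab)) ` snd U = snd V"
    using assms(2) unfolding wtree_iso_def by blast
  have "(\<lambda>(e, lab). ((g \<circ> h) ` e, lab)) ` snd T = snd V"
    unfolding g(2)[symmetric] h(2)[symmetric] image_image by (simp add: case_prod_unfold image_image)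
  with bij_betw_trans[OF h(1) g(1)] show ?thesis
    unfolding wtree_iso_def by blast
qed

section \<open>Letters removed by a cancellation\<close>

text \<open>Cancelling only deletes letters, so a subword cancelled late still carries letters and
  numbers of \<open>W\<close>. The final disjunction separates pairings from negative
  groups.\<close>

lemma cancellation_pairs:
  assumes "cancellation W P" "(k, l) \<in> P"
  shows "\<exists>a b. (k, a) \<in> set W \<and> (l, b) \<in> set W \<and> (b = inv_letter a \<or> fst a \<noteq> fst b \<and> \<not> snd a \<and> \<not> snd b)"
  using assms
proof (induction rule: cancellation.induct)
  case (cancel v x1 x2 P)
  from cancel.prems show ?case
  proof
    assume kl: "(k, l) = (fst (hd v), fst (last v))"
    have v: "v \<noteq> []" using cancel.hyps(1) by (auto simp: pairing_def negative_group_def)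
    have "last (map snd v) = inv_letter (hd (map snd v)) \<or>
        fst (hd (map snd v)) \<noteq> fst (last (map snd v)) \<and> \<not> snd (hd (map snd v)) \<and> \<not> snd (last (map snd v))"
      using cancel.hyps(1) unfolding pairing_def negative_group_def by force
    then have "snd (last v) = inv_letter (snd (hd v)) \<or>
        fst (snd (hd v)) \<noteq> fst (snd (last v)) \<and> \<not> snd (snd (hd v)) \<and> \<not> snd (snd (last v))"
      by (simp only: hd_map[OF v] last_map[OF v])
    moreover have "(k, snd (hd v)) \<in> set (x1 @ v @ x2)" "(l, snd (last v)) \<in> set (x1 @ v @ x2)"
      using kl v by auto
    ultimately show ?thesis by blast
  next
    assume "(k, l) \<in> P"
    then show ?thesis using cancel.IH by auto
  qed
qed simp

text \<open>The final positive word has no negative letter, so each one disappears in some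
  cancellation; there it is an end, because the interior of a cancelled subword is positive.\<close>

lemma cancellation_negative:
  assumes "cancellation W P" "(k, a) \<in> set W" "\<not> snd a"
  shows "\<exists>l. (k, l) \<in> P \<or> (l, k) \<in> P"
  using assms
proof (induction rule: cancellation.induct)
  case (positive W)
  then show ?case by (force simp: positive_word_def)
next
  case (cancel v x1 x2 P)
  show ?case
  proof (cases "(k, a) \<in> set v")
    case True
    \<comment> \<open>Common form of both kinds of subwords, with empty interior \<open>q\<close>
      for a negative group.\<close>
    obtain b q d where v: "v = b # q @ [d]" "positive_word (map snd q)"
    proof (cases "pairing (map snd v)")
      case True
      then obtain a p where p: "positive_word p" "map snd v = a # p @ [inv_letter a]"
        by (auto simp: pairing_def)
      then obtain b v' where v': "v = b # v'" "map snd v' = p @ [inv_letter a]"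
        by (auto simp: map_eq_Cons_conv)
      then obtain q d where "v' = q @ [d]" "map snd q = p"
        by (auto simp: map_eq_append_conv)
      with v' p show thesis using that by blast
    next
      case False
      then show thesis using that[of _ "[]"] cancel.hyps(1)
        by (auto simp: negative_group_def map_eq_Cons_conv positive_word_def)
    qed
    then have "(k, a) \<notin> set q"
      using cancel.prems(2) by (force simp: positive_word_def)
    with True v(1) have "(k, a) = hd v \<or> (k, a) = last v" by auto
    then have "k = fst (hd v) \<or> k = fst (last v)" by (metis fst_conv)
    then show ?thesis by blast
  next
    case False
    then show ?thesis using cancel by auto
  qed
qed

section \<open>The side of the curve on which lifts lie\<close>

lemma inj_on_cis: "inj_on cis {0..<2 * pi}"
proof (rule inj_onI)
  fix a b assume ab: "a \<in> {0..<2 * pi}" "b \<in> {0..<2 * pi}" "cis a = cis b"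
  then have "sin a = sin b \<and> cos a = cos b"
    by (simp add: cis.ctr)
  then obtain j :: int where j: "a = b + 2 * pi * j" using sin_cos_eq_iff by blast
  have "2 * pi * \<bar>real_of_int j\<bar> = \<bar>a - b\<bar>" using j by (simp add: abs_mult)
  also have "\<dots> < 2 * pi * 1" using ab by auto
  finally have "\<bar>real_of_int j\<bar> < 1" using mult_less_cancel_left_pos[of "2 * pi"] pi_gt_zero by simp
  then show "a = b" using j by simp
qed

text \<open>Differentiate the constant \<open>r t \<bullet> r t\<close>.\<close>

lemma spherical_curve_derivative_orthogonal:
  fixes r :: "real \<Rightarrow> 'a::euclidean_space"
  assumes dr: "(r has_vector_derivative v) (at u within T)" and u: "u \<in> T" "at u within T \<noteq> bot"
    and sphere: "\<And>t. t \<in> T \<Longrightarrow> norm (r t) = 1"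
  shows "r u \<bullet> v = 0"
proof -
  have "((\<lambda>t. r t \<bullet> r t) has_vector_derivative (r u \<bullet> v + v \<bullet> r u)) (at u within T)"
    using bounded_bilinear.has_vector_derivative[OF bounded_bilinear_inner dr dr] by simp
  moreover have "((\<lambda>t. r t \<bullet> r t) has_vector_derivative 0) (at u within T)"
    using sphere by (intro has_vector_derivative_transform[OF u(1) _ has_vector_derivative_const[of 1]])
      (simp add: power2_norm_eq_inner[symmetric])
  ultimately have "r u \<bullet> v + v \<bullet> r u = 0"
    using vector_derivative_unique_within u(2) by blast
  then show ?thesis by (simp add: inner_commute)
qed

text \<open>Turns transversality into a nonzero crossing sign: \<open>v\<close> and \<open>u\<close>
  are tangent to the sphere at \<open>p\<close>, so \<open>cross3 v u\<close> is a multiple of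
  \<open>p\<close>, with coefficient \<open>- (v \<bullet> cross3 p u)\<close>.\<close>

lemma inner_cross3_nonzero:
  assumes "norm p = 1" "p \<bullet> v = 0" "p \<bullet> u = 0" "cross3 v u \<noteq> 0"
  shows "v \<bullet> cross3 p u \<noteq> 0"
proof
  assume *: "v \<bullet> cross3 p u = 0"
  have "cross3 p (cross3 v u) = 0"
    using assms by (simp add: Lagrange)
  moreover have "p \<bullet> cross3 v u = - (v \<bullet> cross3 p u)"
    by (simp add: cross3_simps)
  ultimately show False
    using * assms norm_and_cross_eq_0[of p "cross3 v u"] by auto
qed

text \<open>The immersion condition and the left-side condition each supply a derivative; uniqueness
  makes them one \<open>L\<close>. The chain rule along \<open>z * cis t\<close> identifies its
  tangential value.\<close>

lemma extension_derivative:
  assumes F: "extension f F" and z: "z \<in> S1"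
  obtains L where "(F has_derivative L) (at z within D2)" "inj L"
    "0 < L (- z) \<bullet> cross3 (f z) (velocity f z)" "L (\<i> * z) = velocity f z" "f z \<bullet> velocity f z = 0"
proof -
  have zD: "z \<in> D2" using z by simp
  obtain L where L: "(F has_derivative L) (at z within D2)" "0 < L (- z) \<bullet> cross3 (f z) (velocity f z)"
    using F z unfolding extension_def by blast
  obtain M where M: "(F has_derivative M) (at z within D2)" "inj M"
    using F zD unfolding extension_def immersed_disc_def by blast
  have LM: "L = M" by (rule has_derivative_unique_within_disc[OF L(1) M(1) zD])
  let ?p = "\<lambda>t. z * cis t"
  have pS: "?p t \<in> S1" for t using z by (simp add: norm_mult)
  have fF: "f (?p t) = F (?p t)" for t using F pS by (simp add: extension_def)
  have "(?p has_derivative (\<lambda>t. t *\<^sub>R (\<i> * z))) (at 0)"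
    by (auto intro!: derivative_eq_intros simp: fun_eq_iff scaleR_conv_of_real)
  moreover have "(F has_derivative L) (at (?p 0) within ?p ` UNIV)"
  proof -
    have "range ?p \<subseteq> D2" using pS by auto
    then show ?thesis using has_derivative_subset[OF L(1)] by simp
  qed
  ultimately have "((\<lambda>t. F (?p t)) has_derivative (\<lambda>t. L (t *\<^sub>R (\<i> * z)))) (at 0)"
    by (rule has_derivative_in_compose)
  then have d: "((\<lambda>t. f (?p t)) has_vector_derivative L (\<i> * z)) (at 0)"
    using linear_scale[OF has_derivative_linear[OF L(1)]]
    by (simp add: has_vector_derivative_def fF)
  then have vel: "velocity f z = L (\<i> * z)"
    unfolding velocity_def by (rule vector_derivative_at)
  have "norm (f (?p t)) = 1" for t
  proof -
    have "F ` D2 \<subseteq> S2" using F by (simp add: extension_def immersed_disc_def)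
    moreover have "?p t \<in> D2" using pS[of t] by simp
    ultimately have "F (?p t) \<in> S2" by blast
    then show ?thesis by (simp add: fF)
  qed
  with spherical_curve_derivative_orthogonal[OF d] have "f z \<bullet> velocity f z = 0"
    by (simp add: vel)
  then show thesis using L M(2) unfolding LM[symmetric] by (intro that[of L]) (simp_all only: vel)
qed

text \<open>\<open>vector_derivative\<close> is a choice operator; the local smooth extension
  \<open>h\<close> shows that it picks an actual derivative, also at the end points.\<close>

lemma ray_has_vector_derivative:
  assumes "ray f p x0 r" "u \<in> {0..1}"
  shows "(r has_vector_derivative ray_velocity r u) (at u within {0..1})"
proof -
  have "smooth_on {0..1} r" using assms(1) by (simp add: ray_def regular_on_def)
  then obtain U h where U: "open U" "u \<in> U" "\<And>k. Ck_on k h U" "\<And>y. y \<in> {0..1} \<inter> U \<Longrightarrow> h y = r y"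
    using assms(2) unfolding smooth_on_def by meson
  obtain h' where h': "(h has_derivative h') (at u)"
    using U(2) U(3)[of "Suc 0"] by auto
  obtain d where d: "d > 0" "ball u d \<subseteq> U" using U openE by blast
  have "(r has_derivative h') (at u within {0..1})"
  proof (rule has_derivative_transform_within[OF has_derivative_at_withinI[OF h'] d(1) assms(2)])
    fix y assume y: "y \<in> {0..1}" "dist y u < d"
    then have "y \<in> ball u d" by (simp add: dist_commute)
    then show "h y = r y" using U(4) y d(2) by blast
  qed
  then have "r differentiable (at u within {0..1})" by (auto simp: differentiable_def)
  then show ?thesis unfolding ray_velocity_def by (simp add: vector_derivative_works)
qed

text \<open>Where the ray crosses from right to left, a lift can only leave the circle forwards, because the
  disc lies on the left.\<close>

lemma no_backward_lift_of_ray: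
  assumes F: "extension f F" and z: "z \<in> S1" and r: "ray f p x0 r" and u: "u \<in> {0..1}" "r u = f z"
    and pos: "\<not> ray_velocity r u \<bullet> cross3 (f z) (velocity f z) < 0"
    and b: "0 \<le> b" "b < u" and \<alpha>: "continuous_on {b..u} \<alpha>" "\<alpha> ` {b..u} \<subseteq> D2" "\<alpha> u = z"
    and lift: "\<And>t. t \<in> {b..u} \<Longrightarrow> F (\<alpha> t) = r t"
  shows False
proof -
  let ?N = "cross3 (f z) (velocity f z)" and ?v = "ray_velocity r u"
  obtain L where L: "(F has_derivative L) (at z within D2)" "inj L" "0 < L (- z) \<bullet> ?N"
    "L (\<i> * z) = velocity f z" "f z \<bullet> velocity f z = 0"
    using extension_derivative[OF F z] .
  have dr: "(r has_vector_derivative ?v) (at u within {0..1})"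
    by (rule ray_has_vector_derivative[OF r u(1)])
  have sph: "norm (r t) = 1" if "t \<in> {0..1}" for t
    using r that unfolding ray_def path_image_def by force
  have "at u within {0..1} \<noteq> bot"
    using u(1) by (simp add: trivial_limit_within islimpt_Icc)
  then have "f z \<bullet> ?v = 0"
    using spherical_curve_derivative_orthogonal[OF dr u(1) _ sph] u(2) by simp
  moreover have "cross3 ?v (velocity f z) \<noteq> 0"
    using r u z unfolding ray_def by blast
  \<comment> \<open>\<open>pos\<close> says that this value is not negative. Transversality rules
    out zero, so it is positive, against the bound from \<open>no_backward_lift\<close>.\<close>
  ultimately have "?v \<bullet> ?N \<noteq> 0"
    using sph[OF u(1)] u(2) L(5) by (intro inner_cross3_nonzero) auto
  moreover have "L (\<i> * z) \<bullet> ?N = 0" by (simp add: L(4) dot_cross_self)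
  then have "?v \<bullet> ?N \<le> 0"
    using u(1) b
    by (intro no_backward_lift[OF z L(1,3) _ L(2) b(2) \<alpha> lift] has_vector_derivative_within_subset[OF dr]) auto
  ultimately show False using pos by simp
qed

section \<open>Lifting the rays\<close>

locale rayed_curve =
  fixes f :: "complex \<Rightarrow> real^3" and X0 :: "(real^3) set" and x0 :: "real^3"
    and c :: "(real^3) set \<Rightarrow> real \<Rightarrow> real^3" and s :: complex
  assumes X0: "X0 \<in> regions f" and x0: "x0 \<in> X0"
    and rays: "ray_system f X0 x0 c" and s: "s \<in> S1"
begin

abbreviation w :: "(real^3) set letter list" where "w \<equiv> word f X0 c s"
abbreviation m :: "nat \<Rightarrow> complex" where "m \<equiv> mark f X0 c s"
abbreviation X :: "nat \<Rightarrow> (real^3) set" where "X k \<equiv> ray_at f X0 c (m k)"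
abbreviation R :: "nat \<Rightarrow> real \<Rightarrow> real^3" where "R k \<equiv> c (X k)"
abbreviation \<tau> :: "nat \<Rightarrow> real" where "\<tau> k \<equiv> ray_time f (R k) (m k)"

section \<open>Marks on the circle and their rays\<close>

lemma region_disjoint_curve: "Y \<in> regions f \<Longrightarrow> z \<in> S1 \<Longrightarrow> f z \<notin> Y"
  using in_components_subset by blast

lemma x0_off_curve: "z \<in> S1 \<Longrightarrow> f z \<noteq> x0"
  using region_disjoint_curve[OF X0] x0 by blast

lemma crossing_param:
  assumes "k < length w"
  shows "crossing_params f X0 c s ! k
    \<in> {t \<in> {0..<2 * pi}. \<exists>Y\<in>regions f - {X0}. f (s * cis t) \<in> path_image (c Y)}" (is "_ \<in> ?A")
proof -
  have k: "k < length (sorted_list_of_set ?A)"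
    using assms unfolding word_def crossing_params_def length_map .
  \<comment> \<open>\<open>sorted_list_of_set\<close> of an infinite set is empty, so a valid index
    \<open>k\<close> forces finitely many crossings.\<close>
  have "finite ?A"
  proof (rule ccontr)
    assume "infinite ?A"
    then have "sorted_list_of_set ?A = []" by (rule sorted_list_of_set.fold_insort_key.infinite)
    then show False using k by (simp only: list.size not_less_zero)
  qed
  then show ?thesis
    using nth_mem[OF k] unfolding crossing_params_def by (simp only: set_sorted_list_of_set)
qed

lemma mark_crossing:
  assumes "k < length w"
  shows "m k \<in> S1" "\<exists>Y\<in>regions f - {X0}. f (m k) \<in> path_image (c Y)"
  using s crossing_param[OF assms] by (auto simp: mark_def norm_mult)

lemma mark_inj:
  assumes "k < length w" "l < length w" "m k = m l"
  shows "k = l"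
proof -
  let ?L = "crossing_params f X0 c s"
  have "s \<noteq> 0" using s by auto
  then have "cis (?L ! k) = cis (?L ! l)" using assms(3) by (simp add: mark_def)
  then have "?L ! k = ?L ! l"
    using inj_onD[OF inj_on_cis] crossing_param assms(1,2) by blast
  moreover have "distinct ?L" unfolding crossing_params_def by (rule distinct_sorted_list_of_set)
  ultimately show ?thesis using nth_eq_iff_index_eq assms(1,2) by (metis length_map word_def)
qed

lemma rays_meet:
  assumes "Y \<in> regions f - {X0}" "Z \<in> regions f - {X0}" "q \<in> path_image (c Y)" "q \<in> path_image (c Z)" "q \<noteq> x0"
  shows "Y = Z"
  using rays assms unfolding ray_system_def by blast

text \<open>The definite description in \<open>ray_at\<close> is justified: two rays meet only in
  \<open>x0\<close>, which lies in a region and hence off the curve.\<close>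

lemma ray_at_mark:
  assumes "k < length w"
  shows "X k \<in> regions f - {X0}" "f (m k) \<in> path_image (R k)"
proof -
  obtain Y where Y: "Y \<in> regions f - {X0}" "f (m k) \<in> path_image (c Y)"
    using mark_crossing(2)[OF assms] by blast
  have "X k = Y"
    unfolding ray_at_def
  proof (rule the_equality)
    fix Z assume "Z \<in> regions f - {X0} \<and> f (m k) \<in> path_image (c Z)"
    then show "Z = Y"
      by (intro rays_meet[OF _ Y(1) _ Y(2) x0_off_curve[OF mark_crossing(1)[OF assms]]]) simp_all
  qed (use Y in simp)
  with Y show "X k \<in> regions f - {X0}" "f (m k) \<in> path_image (R k)" by auto
qed

lemma R_ray:
  assumes "k < length w"
  shows "ray f (R k 0) x0 (R k)" "R k 0 \<in> X k"
  using rays ray_at_mark(1)[OF assms] unfolding ray_system_def pathstart_def by blast+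

lemma R_inj: "k < length w \<Longrightarrow> inj_on (R k) {0..1}"
  using R_ray(1) by (auto simp: ray_def arc_def)

lemma R_continuous: "k < length w \<Longrightarrow> T \<subseteq> {0..1} \<Longrightarrow> continuous_on T (R k)"
  using R_ray(1)[of k] continuous_on_subset[of "{0..1}" "R k" T] by (simp add: ray_def arc_def path_def)

lemma R_1: "k < length w \<Longrightarrow> R k 1 = x0"
  using R_ray(1) by (auto simp: ray_def pathfinish_def)

text \<open>The inequalities are strict because \<open>R k 0\<close> and \<open>R k 1 = x0\<close>
  lie in the regions \<open>X k\<close> and \<open>X0\<close>, hence off the curve.\<close>

lemma ray_time_mark:
  assumes "k < length w"
  shows "R k (\<tau> k) = f (m k)" "0 < \<tau> k" "\<tau> k < 1"
proof -
  have im: "f (m k) \<in> R k ` {0..1}"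
    using ray_at_mark(2)[OF assms] by (simp add: path_image_def)
  show eq: "R k (\<tau> k) = f (m k)"
    unfolding ray_time_def by (rule f_the_inv_into_f[OF R_inj[OF assms] im])
  have "\<tau> k \<in> {0..1}"
    unfolding ray_time_def by (rule the_inv_into_into[OF R_inj[OF assms] im]) simp
  moreover have "R k 0 \<noteq> f (m k)"
    using R_ray(2)[OF assms] ray_at_mark(1)[OF assms] region_disjoint_curve mark_crossing(1)[OF assms]
    by (metis DiffD1)
  then have "\<tau> k \<noteq> 0" using eq by metis
  moreover have "\<tau> k \<noteq> 1" using eq R_1[OF assms] x0_off_curve[OF mark_crossing(1)[OF assms]] by metis
  ultimately show "0 < \<tau> k" "\<tau> k < 1" by auto
qed

lemma different_rays_meet:
  assumes "k < length w" "l < length w" "X k \<noteq> X l" "t \<in> {0..1}" "u \<in> {0..1}" "R k t = R l u"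
  shows "t = 1" "u = 1"
proof -
  have "R k t \<in> path_image (R k)" "R k t \<in> path_image (R l)"
    using imageI[OF assms(4), of "R k"] imageI[OF assms(5), of "R l"] assms(6) by (simp_all add: path_image_def)
  then have "R k t = x0"
    by (rule contrapos_np[OF assms(3) rays_meet[OF ray_at_mark(1)[OF assms(1)] ray_at_mark(1)[OF assms(2)]]])
  moreover have "R k 1 = x0" "R l 1 = x0" using R_1 assms by auto
  ultimately show "t = 1" "u = 1"
    using inj_onD[OF R_inj[OF assms(1)], of t 1] inj_onD[OF R_inj[OF assms(2)], of u 1] assms(4-6) by auto
qed

lemma letter:
  assumes "k < length w"
  shows "fst (w ! k) = X k"
    "snd (w ! k) \<longleftrightarrow> ray_velocity (R k) (\<tau> k) \<bullet> cross3 (f (m k)) (velocity f (m k)) < 0"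
  using assms by (simp_all add: word_def letter_at_def Let_def mark_def)

section \<open>A single interval and the lift it contains\<close>

definition spans :: "(complex \<Rightarrow> real^3) \<Rightarrow> nat \<Rightarrow> nat \<Rightarrow> complex set \<Rightarrow> bool" where
  "spans F k l A \<longleftrightarrow> k < length w \<and> l < length w \<and> k \<noteq> l \<and> A \<subseteq> D2 \<and> A \<inter> S1 = {m k, m l} \<and>
     (\<exists>g. homeomorphism A (ray_path f X0 c (m k) (m l)) F g)"

lemma ray_path_commute: "ray_path f X0 c a b = ray_path f X0 c b a"
proof (cases "ray_at f X0 c a = ray_at f X0 c b")
  case True
  then show ?thesis
    unfolding ray_path_def Let_def by (metis closed_segment_commute)
next
  case False
  then show ?thesis
    unfolding ray_path_def Let_def by (metis Un_commute)
qed

text \<open>\<open>spans\<close> remembers the point set of an interval and not its direction, so a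
  negative letter can be listed first.\<close>

lemma spans_commute: "spans F k l A \<Longrightarrow> spans F l k A"
  unfolding spans_def ray_path_commute[of "m k" "m l"] insert_commute[of "m k" "m l"] by blast

lemma ray_path_mark:
  "ray_path f X0 c (m k) (m l) =
     (if X k = X l then R k ` closed_segment (\<tau> k) (\<tau> l) else R k ` {\<tau> k..1} \<union> R l ` {\<tau> l..1})"
  by (simp add: ray_path_def Let_def)

text \<open>The inverse of \<open>F\<close> on \<open>A\<close> lifts the ray from
  \<open>m k\<close> on. The lift stops at the other mark for a pairing, over \<open>x0\<close> for
  a negative group. Before \<open>T\<close> it is off the circle, so \<open>T\<close> is intrinsic:
  the first return to the circle or the end of the ray.\<close>

lemma spans_lift:
  assumes F: "extension f F" and A: "spans F k l A" and neg: "\<not> snd (w ! k)"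
  obtains T \<alpha> where "\<tau> k < T" "T \<le> 1" "continuous_on {\<tau> k..T} \<alpha>" "\<alpha> ` {\<tau> k..T} \<subseteq> A" "\<alpha> (\<tau> k) = m k"
    "\<forall>t\<in>{\<tau> k..T}. F (\<alpha> t) = R k t" "\<forall>t\<in>{\<tau> k<..<T}. \<alpha> t \<notin> S1"
    "X k = X l \<longrightarrow> T < 1" "T < 1 \<longrightarrow> \<alpha> T = m l"
    "\<forall>y\<in>A. \<forall>t\<in>{\<tau> k..1}. F y = R k t \<longrightarrow> t \<le> T \<and> \<alpha> t = y"
    "X k = X l \<longrightarrow> F ` A \<subseteq> R k ` {\<tau> k..1}"
proof -
  have k: "k < length w" and l: "l < length w" and kl: "k \<noteq> l" and AD: "A \<subseteq> D2" and AS: "A \<inter> S1 = {m k, m l}"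
    using A by (auto simp: spans_def)
  obtain g where g: "homeomorphism A (ray_path f X0 c (m k) (m l)) F g"
    using A by (auto simp: spans_def)
  have mA: "m k \<in> A" "m l \<in> A" using AS by auto
  have mF: "F (m k) = R k (\<tau> k)" "F (m l) = R l (\<tau> l)"
    using F mark_crossing(1) ray_time_mark(1) k l by (auto simp: extension_def)
  have gF: "g (F y) = y" if "y \<in> A" for y using homeomorphism_apply1[OF g that] .
  \<comment> \<open>On a common ray the negative letter comes first: otherwise the inverse of
    \<open>F\<close> on \<open>A\<close> would lift the ray over \<open>{\<tau> l..\<tau> k}\<close>
    up to \<open>m k\<close>, which \<open>no_backward_lift_of_ray\<close> excludes.\<close>
  have same: "\<tau> k < \<tau> l" "R l = R k" if "X k = X l"
  proof -
    show R: "R l = R k" using that by simp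
    have "\<tau> k \<noteq> \<tau> l"
      using gF[OF mA(1)] gF[OF mA(2)] mF R mark_inj[OF k l] kl by metis
    moreover have False if less: "\<tau> l < \<tau> k"
    proof (rule no_backward_lift_of_ray[OF F mark_crossing(1)[OF k] R_ray(1)[OF k] _ ray_time_mark(1)[OF k] _ _ less])
      have sub: "R k ` {\<tau> l..\<tau> k} = ray_path f X0 c (m k) (m l)"
        using less \<open>X k = X l\<close> by (simp add: ray_path_mark closed_segment_eq_real_ivl)
      have "{\<tau> l..\<tau> k} \<subseteq> {0..1}" using ray_time_mark(2,3)[OF k] ray_time_mark(2)[OF l] by auto
      then have "continuous_on {\<tau> l..\<tau> k} (R k)"
        by (rule R_continuous[OF k])
      then show "continuous_on {\<tau> l..\<tau> k} (\<lambda>t. g (R k t))"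
        by (rule continuous_on_compose2[OF homeomorphism_cont2[OF g]]) (simp only: sub order_refl)
      show "(\<lambda>t. g (R k t)) ` {\<tau> l..\<tau> k} \<subseteq> D2"
        using homeomorphism_image2[OF g] sub AD by blast
      show "g (R k (\<tau> k)) = m k" using gF[OF mA(1)] mF(1) by simp
      show "F (g (R k t)) = R k t" if "t \<in> {\<tau> l..\<tau> k}" for t
        using homeomorphism_apply2[OF g] sub that by blast
    qed (use ray_time_mark(2,3)[OF k] ray_time_mark(2)[OF l] neg letter(2)[OF k] in auto)
    ultimately show "\<tau> k < \<tau> l" by (meson linorder_neqE)
  qed
  define T where "T = (if X k = X l then \<tau> l else 1)"
  define \<alpha> where "\<alpha> = (\<lambda>t. g (R k t))"
  have T: "\<tau> k < T" "T \<le> 1" "X k = X l \<Longrightarrow> T < 1"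
    using ray_time_mark(3)[OF k] ray_time_mark(3)[OF l] same(1) by (auto simp: T_def)
  have T01: "{\<tau> k..T} \<subseteq> {0..1}" using T(2) ray_time_mark(2)[OF k] by auto
  have path: "ray_path f X0 c (m k) (m l) = (if X k = X l then R k ` {\<tau> k..T} else R k ` {\<tau> k..T} \<union> R l ` {\<tau> l..1})"
  proof (cases "X k = X l")
    case True
    then have "closed_segment (\<tau> k) (\<tau> l) = {\<tau> k..T}"
      using same(1)[OF True] unfolding T_def closed_segment_eq_real_ivl by simp
    then show ?thesis unfolding ray_path_mark using True by simp
  next
    case False
    then show ?thesis unfolding ray_path_mark T_def by simp
  qed
  then have sub: "R k ` {\<tau> k..T} \<subseteq> ray_path f X0 c (m k) (m l)" by simp
  have lift: "F (\<alpha> t) = R k t" "\<alpha> t \<in> A" if "t \<in> {\<tau> k..T}" for t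
  proof -
    have "R k t \<in> ray_path f X0 c (m k) (m l)" using sub that by blast
    then show "F (\<alpha> t) = R k t" "\<alpha> t \<in> A"
      unfolding \<alpha>_def using homeomorphism_apply2[OF g] homeomorphism_image2[OF g] by blast+
  qed
  show thesis
  proof (rule that[of T \<alpha>])
    have "continuous_on {\<tau> k..T} (R k)"
      by (rule R_continuous[OF k T01])
    then show "continuous_on {\<tau> k..T} \<alpha>"
      unfolding \<alpha>_def by (rule continuous_on_compose2[OF homeomorphism_cont2[OF g] _ sub])
    show "\<alpha> ` {\<tau> k..T} \<subseteq> A" using lift(2) by blast
    show "\<alpha> (\<tau> k) = m k" unfolding \<alpha>_def using gF[OF mA(1)] mF(1) by simp
    \<comment> \<open>\<open>A\<close> meets the circle only in the two marks. The ray passes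
      \<open>f (m k)\<close> only at time \<open>\<tau> k\<close>. It passes \<open>f (m l)\<close>
      only at \<open>T\<close> for a common ray, and never for different rays, as these meet only at
      time 1 and \<open>\<tau> l < 1\<close>.\<close>
    show "\<forall>t\<in>{\<tau> k<..<T}. \<alpha> t \<notin> S1"
    proof (intro ballI notI)
      fix t assume t: "t \<in> {\<tau> k<..<T}"
      have tT: "t \<in> {\<tau> k..T}" using t by simp
      assume "\<alpha> t \<in> S1"
      with lift(2)[OF tT] have "\<alpha> t \<in> {m k, m l}" unfolding AS[symmetric] by (rule IntI)
      then have "\<alpha> t = m k \<or> \<alpha> t = m l" by simp
      then have "R k t = R k (\<tau> k) \<or> R k t = R l (\<tau> l)"
        using lift(1)[OF tT] mF by metis
      moreover have t01: "t \<in> {0..1}" "\<tau> k \<in> {0..1}" "\<tau> l \<in> {0..1}"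
        using subsetD[OF T01 tT] ray_time_mark(2,3)[OF k] ray_time_mark(2,3)[OF l]
        by (simp_all add: less_imp_le)
      ultimately have "t = \<tau> k \<or> R k t = R l (\<tau> l)" using inj_onD[OF R_inj[OF k]] by metis
      then have tl: "R k t = R l (\<tau> l)" using t by (metis greaterThanLessThan_iff less_irrefl)
      show False
      proof (cases "X k = X l")
        case True
        then have "R k t = R k (\<tau> l)" using tl by simp
        then have "t = \<tau> l" by (rule inj_onD[OF R_inj[OF k] _ t01(1,3)])
        moreover have "T = \<tau> l" using True by (simp add: T_def)
        ultimately show False using t by simp
      next
        case False
        then show False using different_rays_meet(2)[OF k l False t01(1,3) tl] ray_time_mark(3)[OF l] by simp
      qed
    qed
    show "T < 1 \<longrightarrow> \<alpha> T = m l"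
    proof
      assume "T < 1"
      then have "X k = X l" by (auto simp: T_def split: if_splits)
      then show "\<alpha> T = m l" unfolding \<alpha>_def T_def using gF[OF mA(2)] mF(2) by simp
    qed
    show "\<forall>y\<in>A. \<forall>t\<in>{\<tau> k..1}. F y = R k t \<longrightarrow> t \<le> T \<and> \<alpha> t = y"
    proof (intro ballI impI conjI)
      fix y t assume y: "y \<in> A" and t: "t \<in> {\<tau> k..1}" and yt: "F y = R k t"
      show "\<alpha> t = y" unfolding \<alpha>_def using gF[OF y] yt by simp
      show "t \<le> T"
      proof (cases "X k = X l")
        case True
        have "R k t \<in> R k ` {\<tau> k..T}"
          using imageI[OF y, of F] unfolding homeomorphism_image1[OF g] path yt if_P[OF True] .
        then obtain t' where "t' \<in> {\<tau> k..T}" "R k t = R k t'" by blast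
        moreover have "t \<in> {0..1}" using t ray_time_mark(2)[OF k] by auto
        ultimately have "t = t'" using inj_onD[OF R_inj[OF k]] T01 by blast
        then show ?thesis using \<open>t' \<in> {\<tau> k..T}\<close> by simp
      qed (use t in \<open>auto simp: T_def\<close>)
    qed
    show "X k = X l \<longrightarrow> F ` A \<subseteq> R k ` {\<tau> k..1}"
      unfolding homeomorphism_image1[OF g] path using T(2) by (simp add: image_mono)
  qed (use T lift in auto)
qed

section \<open>Comparison of two systems of intervals\<close>

text \<open>Both \<open>\<phi> \<circ> \<alpha>\<close> and \<open>\<beta>\<close> lift the same ray
  through \<open>F2\<close> from \<open>m k\<close>, so they agree as long as both run. The first
  claim concerns points over the ray beyond \<open>\<tau> k\<close>, which for a negative group is
  one of two legs.\<close>

lemma spans_compare: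
  assumes F1: "extension f F1" and F2: "extension f F2" and \<phi>: "homeomorphism D2 D2 \<phi> \<phi>'"
    and bdry: "\<forall>z\<in>S1. \<phi> z = z" and F12: "\<forall>z\<in>D2. F1 z = F2 (\<phi> z)"
    and A: "spans F1 k l A" and B: "spans F2 k l' B" and neg: "\<not> snd (w ! k)"
  shows "y \<in> A \<Longrightarrow> F1 y \<in> R k ` {\<tau> k..1} \<Longrightarrow> \<phi> y \<in> B"
    and "X k = X l \<Longrightarrow> l = l'" and "X k = X l \<Longrightarrow> F1 ` A \<subseteq> R k ` {\<tau> k..1}"
proof -
  have l: "l < length w" "l' < length w" and AD: "A \<subseteq> D2" "B \<subseteq> D2"
    using A B by (simp_all add: spans_def)
  have mS: "m l \<in> S1" "m l' \<in> S1" using mark_crossing(1) l by blast+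
  have k: "m k \<in> S1" using A mark_crossing(1) by (simp add: spans_def)
  obtain T \<alpha> where \<alpha>: "\<tau> k < T" "T \<le> 1" "continuous_on {\<tau> k..T} \<alpha>" "\<alpha> ` {\<tau> k..T} \<subseteq> A" "\<alpha> (\<tau> k) = m k"
    "\<forall>t\<in>{\<tau> k..T}. F1 (\<alpha> t) = R k t" "\<forall>t\<in>{\<tau> k<..<T}. \<alpha> t \<notin> S1"
    "X k = X l \<longrightarrow> T < 1" "T < 1 \<longrightarrow> \<alpha> T = m l"
    "\<forall>y\<in>A. \<forall>t\<in>{\<tau> k..1}. F1 y = R k t \<longrightarrow> t \<le> T \<and> \<alpha> t = y"
    "X k = X l \<longrightarrow> F1 ` A \<subseteq> R k ` {\<tau> k..1}"
    using spans_lift[OF F1 A neg] .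
  obtain U \<beta> where \<beta>: "\<tau> k < U" "U \<le> 1" "continuous_on {\<tau> k..U} \<beta>" "\<beta> ` {\<tau> k..U} \<subseteq> B" "\<beta> (\<tau> k) = m k"
    "\<forall>t\<in>{\<tau> k..U}. F2 (\<beta> t) = R k t" "\<forall>t\<in>{\<tau> k<..<U}. \<beta> t \<notin> S1"
    "X k = X l' \<longrightarrow> U < 1" "U < 1 \<longrightarrow> \<beta> U = m l'"
    "\<forall>y\<in>B. \<forall>t\<in>{\<tau> k..1}. F2 y = R k t \<longrightarrow> t \<le> U \<and> \<beta> t = y"
    "X k = X l' \<longrightarrow> F2 ` B \<subseteq> R k ` {\<tau> k..1}"
    using spans_lift[OF F2 B neg] .
  note \<alpha> = \<alpha>[rule_format] and \<beta> = \<beta>[rule_format]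
  have \<phi>_inj: "a = b" if "a \<in> D2" "b \<in> D2" "\<phi> a = \<phi> b" for a b
    using homeomorphism_apply1[OF \<phi>] that by metis
  have same: "\<phi> (\<alpha> t) = \<beta> t" if t: "t \<in> {\<tau> k..min T U}" for t
  proof (rule immersed_disc_lift_unique[of F2 "{\<tau> k..min T U}" "\<tau> k"])
    show "immersed_disc F2" using F2 by (simp add: extension_def)
    show "\<tau> k \<in> {\<tau> k..min T U}" using \<alpha>(1) \<beta>(1) by simp
    have "{\<tau> k..min T U} \<subseteq> {\<tau> k..T}" "{\<tau> k..min T U} \<subseteq> {\<tau> k..U}" by auto
    note sub = this
    have \<alpha>D: "\<alpha> ` {\<tau> k..min T U} \<subseteq> D2" by (rule order_trans[OF order_trans[OF image_mono[OF sub(1)] \<alpha>(4)] AD(1)])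
    show "continuous_on {\<tau> k..min T U} (\<lambda>t. \<phi> (\<alpha> t))"
      by (rule continuous_on_compose2[OF homeomorphism_cont1[OF \<phi>] continuous_on_subset[OF \<alpha>(3) sub(1)] \<alpha>D])
    show "(\<lambda>t. \<phi> (\<alpha> t)) ` {\<tau> k..min T U} \<subseteq> D2"
      using \<alpha>D homeomorphism_image1[OF \<phi>] by blast
    show "continuous_on {\<tau> k..min T U} \<beta>" by (rule continuous_on_subset[OF \<beta>(3) sub(2)])
    show "\<beta> ` {\<tau> k..min T U} \<subseteq> D2" by (rule order_trans[OF order_trans[OF image_mono[OF sub(2)] \<beta>(4)] AD(2)])
    show "F2 (\<phi> (\<alpha> t)) = F2 (\<beta> t)" if t: "t \<in> {\<tau> k..min T U}" for t
      using bspec[OF F12, of "\<alpha> t"] \<alpha>D \<alpha>(6)[of t] \<beta>(6)[of t] t by (simp add: image_subset_iff)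
    show "\<phi> (\<alpha> (\<tau> k)) = \<beta> (\<tau> k)" using \<alpha>(5) \<beta>(5) bspec[OF bdry k] by simp
  qed (use t in auto)
  \<comment> \<open>The lift that stops first does so on the circle, which \<open>\<phi>\<close>
    fixes, while the other one would still be in the open disc. When \<open>\<beta>\<close> stops
    first, injectivity of \<open>\<phi>\<close> carries this back to
    \<open>\<alpha>\<close>.\<close>
  have TU: "T = U"
  proof (rule linorder_cases[of T U])
    assume less: "T < U"
    then have "\<alpha> T = m l" using \<alpha>(9) \<beta>(2) by simp
    then have "\<beta> T \<in> S1" using same[of T] less \<alpha>(1) bspec[OF bdry mS(1)] mS(1) by simp
    then show ?thesis using \<beta>(7)[of T] less \<alpha>(1) by simp
  next
    assume less: "U < T"
    then have "\<beta> U = m l'" using \<beta>(9) \<alpha>(2) by simp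
    then have "\<phi> (\<alpha> U) = \<phi> (m l')" using same[of U] less \<beta>(1) bspec[OF bdry mS(2)] by simp
    moreover have "U \<in> {\<tau> k..T}" using less \<beta>(1) by simp
    then have "\<alpha> U \<in> D2" by (rule subsetD[OF AD(1) subsetD[OF \<alpha>(4) imageI]])
    ultimately have "\<alpha> U = m l'" using \<phi>_inj mS(2) by simp
    then show ?thesis using \<alpha>(7)[of U] less \<beta>(1) mS(2) by simp
  qed
  show "\<phi> y \<in> B" if y: "y \<in> A" and F1y: "F1 y \<in> R k ` {\<tau> k..1}"
  proof -
    obtain t where t: "t \<in> {\<tau> k..1}" "F1 y = R k t" using F1y by blast
    then have "t \<le> T" "\<alpha> t = y" using \<alpha>(10)[OF y] by blast+
    then show ?thesis using same[of t] \<beta>(4) t(1) TU by (auto simp: image_subset_iff)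
  qed
  show "l = l'" if "X k = X l"
  proof -
    have "T < 1" using \<alpha>(8)[OF that] .
    then have "\<alpha> T = m l" "\<beta> T = m l'" using \<alpha>(9) \<beta>(9) TU by simp_all
    moreover have "\<phi> (\<alpha> T) = \<beta> T" using same[of T] TU \<alpha>(1) by simp
    ultimately have "m l = m l'" using bspec[OF bdry mS(1)] by simp
    then show ?thesis using mark_inj l by blast
  qed
  show "F1 ` A \<subseteq> R k ` {\<tau> k..1}" if "X k = X l" using \<alpha>(11)[OF that] .
qed

section \<open>Interval systems of an extension\<close>

definition inducing :: "(complex \<Rightarrow> real^3) \<Rightarrow> (nat \<times> nat) set \<Rightarrow> (nat \<times> nat \<Rightarrow> real \<Rightarrow> complex) \<Rightarrow> bool" where
  "inducing F P \<gamma> \<longleftrightarrow>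
     cancellation (List.enumerate 0 w) P \<and> interval_system m P \<gamma> \<and>
     (\<forall>(k, l)\<in>P. diffeomorphism (path_image (\<gamma> (k, l))) (ray_path f X0 c (m k) (m l)) F)"

lemma inducing_letters:
  assumes "inducing F P \<gamma>" "(k, l) \<in> P"
  shows "k < length w" "l < length w"
    "w ! l = inv_letter (w ! k) \<or> X k \<noteq> X l \<and> \<not> snd (w ! k) \<and> \<not> snd (w ! l)"
proof -
  have "cancellation (List.enumerate 0 w) P" using assms(1) unfolding inducing_def by (rule conjunct1)
  then obtain a b where ab: "(k, a) \<in> set (List.enumerate 0 w)" "(l, b) \<in> set (List.enumerate 0 w)"
    "b = inv_letter a \<or> fst a \<noteq> fst b \<and> \<not> snd a \<and> \<not> snd b"
    using cancellation_pairs[OF _ assms(2)] by blast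
  then have k: "k < length w" "a = w ! k" and l: "l < length w" "b = w ! l"
    unfolding in_set_enumerate_eq by simp_all
  show "k < length w" "l < length w" by (fact k(1) l(1))+
  show "w ! l = inv_letter (w ! k) \<or> X k \<noteq> X l \<and> \<not> snd (w ! k) \<and> \<not> snd (w ! l)"
    using ab(3) unfolding k(2) l(2) letter(1)[OF k(1)] letter(1)[OF l(1)] .
qed

lemma inducing_spans:
  assumes ind: "inducing F P \<gamma>" and e: "(k, l) \<in> P"
  shows "spans F k l (path_image (\<gamma> (k, l)))"
proof -
  have kl: "k < length w" "l < length w" using inducing_letters[OF ind e] by blast+
  have \<gamma>: "disc_interval (m k) (m l) (\<gamma> (k, l))"
    using ind e unfolding inducing_def interval_system_def by blast
  have ends: "\<gamma> (k, l) 0 = m k" "\<gamma> (k, l) 1 = m l"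
    using \<gamma> by (auto simp: disc_interval_def pathstart_def pathfinish_def)
  have int: "\<gamma> (k, l) t \<in> ball 0 1" if "t \<in> {0<..<1}" for t
    using \<gamma> that by (auto simp: disc_interval_def)
  have mS: "m k \<in> S1" "m l \<in> S1" using mark_crossing(1) kl by blast+
  have "m k \<noteq> m l"
    using \<gamma> arc_distinct_ends[of "\<gamma> (k, l)"] by (auto simp: disc_interval_def)
  then have neq: "k \<noteq> l" by blast
  have "{0..1::real} = {0, 1} \<union> {0<..<1}" by auto
  then have im: "path_image (\<gamma> (k, l)) = {m k, m l} \<union> \<gamma> (k, l) ` {0<..<1}"
    using ends by (simp add: path_image_def)
  have "\<gamma> (k, l) ` {0<..<1} \<subseteq> ball 0 1" using int by blast
  then have "path_image (\<gamma> (k, l)) \<subseteq> D2" "path_image (\<gamma> (k, l)) \<inter> S1 = {m k, m l}"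
    unfolding im using mS by auto
  moreover have "\<exists>g. homeomorphism (path_image (\<gamma> (k, l))) (ray_path f X0 c (m k) (m l)) F g"
    using ind e unfolding inducing_def diffeomorphism_def by blast
  ultimately show ?thesis
    using kl neq by (simp add: spans_def)
qed

text \<open>Lists the negative letter first, whichever position it has in the pair, because
  \<open>spans_lift\<close> starts at a negative letter.\<close>

lemma inducing_negative:
  assumes ind: "inducing F P \<gamma>" and k: "k < length w" "\<not> snd (w ! k)"
  obtains e l where "e \<in> P" "{fst e, snd e} = {k, l}" "spans F k l (path_image (\<gamma> e))"
proof -
  have "(k, w ! k) \<in> set (List.enumerate 0 w)"
    using k(1) by (simp add: in_set_enumerate_eq)
  moreover have "cancellation (List.enumerate 0 w) P" using ind unfolding inducing_def by (rule conjunct1)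
  ultimately obtain l where "(k, l) \<in> P \<or> (l, k) \<in> P"
    using cancellation_negative[OF _ _ k(2)] by blast
  then show thesis
  proof
    assume "(k, l) \<in> P"
    then show thesis using that[of "(k, l)" l] inducing_spans[OF ind] by simp
  next
    assume "(l, k) \<in> P"
    then show thesis
      using that[of "(l, k)" l] spans_commute[OF inducing_spans[OF ind]] by (simp add: insert_commute)
  qed
qed

text \<open>A pairing has exactly one negative letter, which is taken as \<open>k\<close>; in a
  negative group either letter can start.\<close>

lemma inducing_edge:
  assumes ind: "inducing F P \<gamma>" and e: "e \<in> P"
  obtains k l where "{fst e, snd e} = {k, l}" "spans F k l (path_image (\<gamma> e))" "\<not> snd (w ! k)"
    "X k = X l \<or> \<not> snd (w ! l)"
proof -
  obtain i j where ij: "e = (i, j)" by (cases e)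
  note letters = inducing_letters[OF ind e[unfolded ij]]
  note sp = inducing_spans[OF ind e[unfolded ij]]
  have X: "X i = X j" if "w ! j = inv_letter (w ! i)"
    using that letter(1) letters(1,2) by (metis fst_conv inv_letter_def)
  show thesis
  proof (cases "snd (w ! i)")
    case True
    then have "w ! j = inv_letter (w ! i)" using letters(3) by blast
    then have "X j = X i" "\<not> snd (w ! j)" using X True by (simp_all add: inv_letter_def)
    then show thesis
      using that[of j i] ij spans_commute[OF sp] by (simp add: insert_commute)
  next
    case False
    then show thesis using that[of i j] ij sp X letters(3) by auto
  qed
qed

lemma inducing_unique:
  assumes "inducing F P \<gamma>" "e \<in> P" "e' \<in> P" "y \<in> path_image (\<gamma> e)" "y \<in> path_image (\<gamma> e')"
  shows "e = e'"
  using assms unfolding inducing_def interval_system_def pairwise_def disjnt_iff by blast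

text \<open>For a negative group the lifts of its two legs meet over \<open>x0\<close>, so both letters belong to the same
  interval of the second system.\<close>

lemma inducing_match:
  assumes F1: "extension f F1" and F2: "extension f F2" and \<phi>: "homeomorphism D2 D2 \<phi> \<phi>'"
    and bdry: "\<forall>z\<in>S1. \<phi> z = z" and F12: "\<forall>z\<in>D2. F1 z = F2 (\<phi> z)"
    and P: "inducing F1 P \<gamma>" and Q: "inducing F2 Q \<delta>" and e: "e \<in> P"
  shows "\<exists>e'\<in>Q. \<phi> ` path_image (\<gamma> e) = path_image (\<delta> e') \<and> {fst e, snd e} = {fst e', snd e'}"
proof -
  let ?A = "path_image (\<gamma> e)"
  obtain k l where kl: "{fst e, snd e} = {k, l}" "spans F1 k l ?A" "\<not> snd (w ! k)" "X k = X l \<or> \<not> snd (w ! l)"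
    using inducing_edge[OF P e] .
  have k: "k < length w" and l: "l < length w" and neq: "k \<noteq> l" and AD: "?A \<subseteq> D2"
    using kl(2) by (auto simp: spans_def)
  obtain e' l' where e': "e' \<in> Q" "{fst e', snd e'} = {k, l'}" "spans F2 k l' (path_image (\<delta> e'))"
    using inducing_negative[OF Q k kl(3)] .
  let ?B = "path_image (\<delta> e')"
  note cmp = spans_compare[OF F1 F2 \<phi> bdry F12 kl(2) e'(3) kl(3)]
  obtain g where g: "homeomorphism ?A (ray_path f X0 c (m k) (m l)) F1 g"
    using kl(2) by (auto simp: spans_def)
  have "l' = l \<and> \<phi> ` ?A \<subseteq> ?B"
  proof (cases "X k = X l")
    case True
    have "\<phi> ` ?A \<subseteq> ?B"
    proof (rule image_subsetI)
      fix y assume y: "y \<in> ?A"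
      have "F1 y \<in> R k ` {\<tau> k..1}" by (rule subsetD[OF cmp(3)[OF True] imageI[OF y]])
      then show "\<phi> y \<in> ?B" by (rule cmp(1)[OF y])
    qed
    then show ?thesis using cmp(2)[OF True] by simp
  next
    case False
    then have negl: "\<not> snd (w ! l)" using kl(4) by simp
    obtain e'' l'' where e'': "e'' \<in> Q" "{fst e'', snd e''} = {l, l''}" "spans F2 l l'' (path_image (\<delta> e''))"
      using inducing_negative[OF Q l negl] .
    note cmp' = spans_compare[OF F1 F2 \<phi> bdry F12 spans_commute[OF kl(2)] e''(3) negl]
    have ray: "F1 ` ?A = R k ` {\<tau> k..1} \<union> R l ` {\<tau> l..1}"
      using homeomorphism_image1[OF g] False by (simp add: ray_path_mark)
    have x0_in: "x0 \<in> R k ` {\<tau> k..1}" "x0 \<in> R l ` {\<tau> l..1}"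
      using R_1 ray_time_mark(3) k l by (force simp: image_iff)+
    then have "x0 \<in> F1 ` ?A" unfolding ray by blast
    then obtain q where q: "q \<in> ?A" "F1 q = x0" by blast
    have "\<phi> q \<in> ?B" "\<phi> q \<in> path_image (\<delta> e'')"
      using cmp(1)[OF q(1)] cmp'(1)[OF q(1)] x0_in unfolding q(2) by blast+
    then have "e' = e''" using inducing_unique[OF Q e'(1) e''(1)] by blast
    \<comment> \<open>The same pair is labelled by \<open>{k, l'}\<close> and by
      \<open>{l, l''}\<close>, and \<open>k \<noteq> l\<close>.\<close>
    then have "l' = l" using e'(2) e''(2) neq by (metis doubleton_eq_iff)
    moreover have "\<phi> ` ?A \<subseteq> ?B"
    proof (rule image_subsetI)
      fix y assume y: "y \<in> ?A"
      have "F1 y \<in> R k ` {\<tau> k..1} \<or> F1 y \<in> R l ` {\<tau> l..1}"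
        using imageI[OF y, of F1] unfolding ray by blast
      then show "\<phi> y \<in> ?B"
        using cmp(1)[OF y] cmp'(1)[OF y] \<open>e' = e''\<close> by blast
    qed
    ultimately show ?thesis by blast
  qed
  then have l': "l' = l" and sub: "\<phi> ` ?A \<subseteq> ?B" by blast+
  \<comment> \<open>With \<open>l' = l\<close> both intervals map onto the same ray path, and
    \<open>F2\<close> is injective on \<open>?B\<close>; so the point of \<open>?B\<close> over
    \<open>F1 x\<close> must be \<open>\<phi> x\<close>.\<close>
  have "?B \<subseteq> \<phi> ` ?A"
  proof
    fix y assume y: "y \<in> ?B"
    obtain h where h: "homeomorphism ?B (ray_path f X0 c (m k) (m l)) F2 h"
      using e'(3) l' by (auto simp: spans_def)
    have "F2 y \<in> F1 ` ?A"
      using imageI[OF y, of F2] unfolding homeomorphism_image1[OF h] homeomorphism_image1[OF g] .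
    then obtain x where x: "x \<in> ?A" "F2 y = F1 x" by blast
    then have "F2 y = F2 (\<phi> x)" using F12 AD by auto
    then have "y = \<phi> x"
      using homeomorphism_apply1[OF h] y sub x(1) by (metis imageI subsetD)
    then show "y \<in> \<phi> ` ?A" using x(1) by blast
  qed
  then show ?thesis using sub e'(1,2) kl(1) l' by auto
qed

text \<open>The interval of \<open>P\<close> at the same negative letter is matched with some
  interval of \<open>Q\<close> through \<open>m k\<close>, and disjointness makes this one
  \<open>e'\<close>.\<close>

lemma inducing_match_converse:
  assumes F1: "extension f F1" and F2: "extension f F2" and \<phi>: "homeomorphism D2 D2 \<phi> \<phi>'"
    and bdry: "\<forall>z\<in>S1. \<phi> z = z" and F12: "\<forall>z\<in>D2. F1 z = F2 (\<phi> z)"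
    and P: "inducing F1 P \<gamma>" and Q: "inducing F2 Q \<delta>" and e': "e' \<in> Q"
  shows "\<exists>e\<in>P. \<phi> ` path_image (\<gamma> e) = path_image (\<delta> e') \<and> {fst e, snd e} = {fst e', snd e'}"
proof -
  obtain k l where kl: "{fst e', snd e'} = {k, l}" "spans F2 k l (path_image (\<delta> e'))" "\<not> snd (w ! k)"
    "X k = X l \<or> \<not> snd (w ! l)"
    using inducing_edge[OF Q e'] .
  then have k: "k < length w" by (simp add: spans_def)
  obtain e j where e: "e \<in> P" "{fst e, snd e} = {k, j}" "spans F1 k j (path_image (\<gamma> e))"
    using inducing_negative[OF P k kl(3)] .
  obtain d where d: "d \<in> Q" "\<phi> ` path_image (\<gamma> e) = path_image (\<delta> d)" "{fst e, snd e} = {fst d, snd d}"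
    using inducing_match[OF F1 F2 \<phi> bdry F12 P Q e(1)] by blast
  have "m k \<in> path_image (\<gamma> e)" "m k \<in> path_image (\<delta> e')"
    using e(3) kl(2) by (auto simp: spans_def)
  moreover have "\<phi> (m k) = m k" using bdry mark_crossing(1)[OF k] by blast
  ultimately have "d = e'"
    using inducing_unique[OF Q d(1) e'] d(2) by (metis imageI)
  with d e(1) show ?thesis by blast
qed

section \<open>Equivalent extensions have isomorphic trees\<close>

lemma induced_by_inducing:
  assumes "induced_by f X0 c s G F"
  obtains P \<gamma> where "inducing F P \<gamma>" "wtree_iso (interval_tree P \<gamma>) G"
  using assms unfolding induced_by_def inducing_def by blast

text \<open>\<open>\<phi>\<close> matches the intervals and hence the interval trees, and each
  grouping is isomorphic to the tree of a system inducing its extension.\<close>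

lemma equivalent_extensions_induced_iso:
  assumes F: "extension f F1" "extension f F2"
    and ind: "induced_by f X0 c s G1 F1" "induced_by f X0 c s G2 F2"
    and eq: "equivalent_extensions F1 F2"
  shows "wtree_iso G1 G2"
proof -
  obtain P \<gamma> where P: "inducing F1 P \<gamma>" "wtree_iso (interval_tree P \<gamma>) G1"
    using induced_by_inducing[OF ind(1)] .
  obtain Q \<delta> where Q: "inducing F2 Q \<delta>" "wtree_iso (interval_tree Q \<delta>) G2"
    using induced_by_inducing[OF ind(2)] .
  obtain \<phi> \<phi>' where \<phi>: "homeomorphism D2 D2 \<phi> \<phi>'" "\<forall>z\<in>S1. \<phi> z = z"
    "\<forall>z\<in>D2. F1 z = F2 (\<phi> z)"
    using eq unfolding equivalent_extensions_def diffeomorphism_def by blast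
  have "path_image (\<gamma> e) \<subseteq> D2" if "e \<in> P" for e
    using inducing_spans[OF P(1), of "fst e" "snd e"] that by (simp add: spans_def)
  then have "wtree_iso (interval_tree P \<gamma>) (interval_tree Q \<delta>)"
    using inducing_match[OF F \<phi> P(1) Q(1)] inducing_match_converse[OF F \<phi> P(1) Q(1)]
    by (intro interval_tree_iso[OF \<phi>(1)])
  moreover have "wtree_iso G1 (interval_tree P \<gamma>)"
    by (rule wtree_iso_sym[OF P(2)]) (auto simp: interval_tree_eq)
  ultimately show ?thesis using wtree_iso_trans Q(2) by blast
qed

end

theorem theorem4p3p3:
  fixes f F1 F2 :: "complex \<Rightarrow> real^3"
    and \<psi> :: "(real^3) set \<Rightarrow> int"
    and X0 :: "(real^3) set"
    and x0 :: "real^3"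
    and c :: "(real^3) set \<Rightarrow> real \<Rightarrow> real^3"
    and s :: complex
    and G1 G2 :: "complex set wtree"
  assumes "normal_immersion f"
    and "numbering f \<psi>"
    and "base_region f \<psi> X0"
    and "x0 \<in> X0"
    and "ray_system f X0 x0 c"
    and "s \<in> S1"
    and "reduced_word (word f X0 c s)"
    and "grouping f X0 c s G1"
    and "grouping f X0 c s G2"
    and "\<not> wtree_iso G1 G2"
    and "extension f F1"
    and "extension f F2"
    and "induced_by f X0 c s G1 F1"
    and "induced_by f X0 c s G2 F2"
  shows "\<not> equivalent_extensions F1 F2"
proof -
  interpret rayed_curve f X0 x0 c s
    using assms(3-6) by unfold_locales (simp_all add: base_region_def)
  show ?thesis
    using equivalent_extensions_induced_iso assms(10-14) by blast
qed

end
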